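(* Let $p\ge1$ be an integer and $k\in\{1,2,3,4,5\}$, with $(p,k)\notin\{(1,1),(1,3)\}$. Then for $\tau\in\mathbb{H}$, $q=e^{2\pi i\tau}$, $$H_p^{(k)}(q)=\frac{q^{-\frac{e_k}{24(6p-1)}}}{2\eta(\tau)}\sum_{\varepsilon=(\varepsilon_1,\varepsilon_2)^T\in\{0,1\}^2}(-1)^{\varepsilon_1+\varepsilon_2}\Big(\widetilde{\theta}^{(2)}_{\mu_k+\varepsilon,c_1}(\tau)+\widetilde{\theta}^{(2)}_{\mu_k+\varepsilon,c_2}(\tau)\Big),$$ where $$\mu_1=\tfrac12A^{-1}\begin{pmatrix} 2p+1 \\ 5 \end{pmatrix},\ \mu_2=\tfrac12A^{-1}\begin{pmatrix} 1 \\ 1 \end{pmatrix},\ \mu_3=\tfrac12A^{-1}\begin{pmatrix} 2p+3 \\ 3 \end{pmatrix},\ \mu_4=\tfrac12A^{-1}\begin{pmatrix} 2p+1 \\ 1 \end{pmatrix},\ \mu_5=\tfrac12A^{-1}\begin{pmatrix} 1 \\ 3 \end{pmatrix}$$ and $$e_1=(6p+5)^2,\quad e_2=1,\quad e_3=36p^2+84p+1,\quad e_4=(6p+1)^2,\quad e_5=48p+1.$$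
   Context: For $\tau\in\mathbb{H}$ put $q=e^{2\pi i\tau}$, $q^r=e^{2\pi ir\tau}$ for $r\in\mathbb{Q}$. $(x)_n=\prod_{k=0}^{n-1}(1-xq^k)$, $(q)_\infty=\prod_{k\ge1}(1-q^k)$, $\eta(\tau)=q^{1/24}(q)_\infty$, $\begin{bmatrix} n \\ k \end{bmatrix}_q=\frac{(q)_n}{(q)_k(q)_{n-k}}$. Habiro-type series, for $p\ge1$ and $|q|<1$ (sums over integers $s_p\ge\cdots\ge s_1\ge0$, empty products equal $1$): $H_p^{(1)}(q)=\sum q^{s_p}(q^{s_p+1})_{s_p+1}\prod_{i=1}^{p-1}q^{s_i(s_i+1)}\begin{bmatrix} s_{i+1} \\ s_i \end{bmatrix}_q$, $H_p^{(2)}(q)=\sum q^{s_p}(q^{s_p})_{s_p}\prod_{i=1}^{p-1}q^{s_i^2}\begin{bmatrix} s_{i+1} \\ s_i \end{bmatrix}_q$, $H_p^{(3)}(q)=\sum q^{2s_p}(q^{s_p+1})_{s_p}\prod_{i=1}^{p-1}q^{s_i(s_i+1)}\begin{bmatrix} s_{i+1} \\ s_i \end{bmatrix}_q$, $H_p^{(4)}(q)=\sum q^{s_p}(q^{s_p+1})_{s_p}\prod_{i=1}^{p-1}q^{s_i(s_i+1)}\begin{bmatrix} s_{i+1} \\ s_i \end{bmatrix}_q$, $H_p^{(5)}(q)=\sum q^{s_p}(q^{s_p+1})_{s_p}\prod_{i=1}^{p-1}q^{s_i^2}\begin{bmatrix} s_{i+1} \\ s_i \end{bmatrix}_q$. False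 theta functions: $A=\begin{pmatrix} 2p+1 & 2 \\ 2 & 3 \end{pmatrix}$, $B(x,y)=x^TAy$, $Q(x)=\frac12B(x,x)$, $L=2\mathbb{Z}^2$, dual lattice $L^*=\frac12A^{-1}\mathbb{Z}^2$, $c_1=\frac{1}{\sqrt{3(6p-1)}}(3,-2)^T$, $c_2=\frac{1}{\sqrt{(2p+1)(6p-1)}}(-2,2p+1)^T$. For $\mu\in L^*$ and $c\in\{c_1,c_2\}$, $\widetilde{\theta}^{(2)}_{\mu,c}(\tau)=\sum_{n\in L+\mu}\operatorname{sgn}(B(n,c))q^{Q(n)}$, with $\operatorname{sgn}(0)=0$. *)

theory Defs
  imports "HOL-Analysis.Analysis"
begin

section \<open>\<open>q\<close>-series\<close>

definition qpow :: "complex \<Rightarrow> real \<Rightarrow> complex" where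
  "qpow \<tau> r = exp (2 * of_real pi * \<i> * of_real r * \<tau>)"

definition qpoch :: "complex \<Rightarrow> complex \<Rightarrow> nat \<Rightarrow> complex" where
  "qpoch q x n = (\<Prod>k<n. 1 - x * q ^ k)"

definition qpoch_inf :: "complex \<Rightarrow> complex" where
  "qpoch_inf q = prodinf (\<lambda>k. 1 - q ^ Suc k)"

definition dedekind_eta :: "complex \<Rightarrow> complex" where
  "dedekind_eta \<tau> = qpow \<tau> (1/24) * qpoch_inf (qpow \<tau> 1)"

text \<open>Only used for \<open>k \<le> n\<close>; for \<open>k > n\<close> the truncated subtraction makes the value meaningless.\<close>

definition qbinom :: "complex \<Rightarrow> nat \<Rightarrow> nat \<Rightarrow> complex" where
  "qbinom q n k = qpoch q q n / (qpoch q q k * qpoch q q (n - k))"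

section \<open>Habiro-type series\<close>

text \<open>The tuples \<open>s\<^sub>p \<ge> \<dots> \<ge> s\<^sub>1 \<ge> 0\<close>, as functions with value \<open>undefined\<close> outside \<open>{1..p}\<close>
  (so that each tuple occurs exactly once).\<close>

definition chains :: "nat \<Rightarrow> (nat \<Rightarrow> nat) set" where
  "chains p = {s \<in> {1..p} \<rightarrow>\<^sub>E UNIV. \<forall>i\<in>{1..<p}. s i \<le> s (i + 1)}"

definition habiro1 :: "nat \<Rightarrow> complex \<Rightarrow> complex" where
  "habiro1 p q = (\<Sum>\<^sub>\<infinity>s\<in>chains p. q ^ s p * qpoch q (q ^ (s p + 1)) (s p + 1) *
     (\<Prod>i\<in>{1..<p}. q ^ (s i * (s i + 1)) * qbinom q (s (i + 1)) (s i)))"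

definition habiro2 :: "nat \<Rightarrow> complex \<Rightarrow> complex" where
  "habiro2 p q = (\<Sum>\<^sub>\<infinity>s\<in>chains p. q ^ s p * qpoch q (q ^ s p) (s p) *
     (\<Prod>i\<in>{1..<p}. q ^ (s i)\<^sup>2 * qbinom q (s (i + 1)) (s i)))"

definition habiro3 :: "nat \<Rightarrow> complex \<Rightarrow> complex" where
  "habiro3 p q = (\<Sum>\<^sub>\<infinity>s\<in>chains p. q ^ (2 * s p) * qpoch q (q ^ (s p + 1)) (s p) *
     (\<Prod>i\<in>{1..<p}. q ^ (s i * (s i + 1)) * qbinom q (s (i + 1)) (s i)))"

definition habiro4 :: "nat \<Rightarrow> complex \<Rightarrow> complex" where
  "habiro4 p q = (\<Sum>\<^sub>\<infinity>s\<in>chains p. q ^ s p * qpoch q (q ^ (s p + 1)) (s p) *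
     (\<Prod>i\<in>{1..<p}. q ^ (s i * (s i + 1)) * qbinom q (s (i + 1)) (s i)))"

definition habiro5 :: "nat \<Rightarrow> complex \<Rightarrow> complex" where
  "habiro5 p q = (\<Sum>\<^sub>\<infinity>s\<in>chains p. q ^ s p * qpoch q (q ^ (s p + 1)) (s p) *
     (\<Prod>i\<in>{1..<p}. q ^ (s i)\<^sup>2 * qbinom q (s (i + 1)) (s i)))"

text \<open>The families below are indexed by \<open>k \<in> {1,\<dots>,5}\<close>; list indices start at \<open>0\<close>,
  hence the shift.\<close>

definition habiro :: "nat \<Rightarrow> nat \<Rightarrow> complex \<Rightarrow> complex" where
  "habiro k p q = [habiro1 p q, habiro2 p q, habiro3 p q, habiro4 p q, habiro5 p q] ! (k - 1)"

section \<open>False theta functions\<close>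

definition Amat :: "nat \<Rightarrow> real^2^2" where
  "Amat p = vector [vector [2 * real p + 1, 2], vector [2, 3]]"

definition Bform :: "nat \<Rightarrow> real^2 \<Rightarrow> real^2 \<Rightarrow> real" where
  "Bform p x y = x \<bullet> (Amat p *v y)"

definition Qform :: "nat \<Rightarrow> real^2 \<Rightarrow> real" where
  "Qform p x = Bform p x x / 2"

definition Llat :: "(real^2) set" where
  "Llat = {x. \<forall>i. \<exists>m::int. x $ i = 2 * of_int m}"

definition c1 :: "nat \<Rightarrow> real^2" where
  "c1 p = (1 / sqrt (3 * (6 * real p - 1))) *\<^sub>R vector [3, -2]"

definition c2 :: "nat \<Rightarrow> real^2" where
  "c2 p = (1 / sqrt ((2 * real p + 1) * (6 * real p - 1))) *\<^sub>R vector [-2, 2 * real p + 1]"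

definition false_theta :: "nat \<Rightarrow> real^2 \<Rightarrow> real^2 \<Rightarrow> complex \<Rightarrow> complex" where
  "false_theta p \<mu> c \<tau> =
     (\<Sum>\<^sub>\<infinity>n\<in>(\<lambda>x. x + \<mu>) ` Llat. of_real (sgn (Bform p n c)) * qpow \<tau> (Qform p n))"

definition mu :: "nat \<Rightarrow> nat \<Rightarrow> real^2" where
  "mu k p = (1/2) *\<^sub>R (matrix_inv (Amat p) *v
     ([vector [2 * real p + 1, 5],
       vector [1, 1],
       vector [2 * real p + 3, 3],
       vector [2 * real p + 1, 1],
       vector [1, 3]] ! (k - 1)))"

definition ecoef :: "nat \<Rightarrow> nat \<Rightarrow> real" where
  "ecoef k p =
     [(6 * real p + 5)\<^sup>2,
      1,
      36 * (real p)\<^sup>2 + 84 * real p + 1,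
      (6 * real p + 1)\<^sup>2,
      48 * real p + 1] ! (k - 1)"

end

theory Submission
  imports Defs
begin

text \<open>
  Put \<open>\<mu>\<^sub>k = A\<inverse>v/2\<close> and \<open>T(m,n) = (-1)\<^bsup>m+n\<^esup> q\<^bsup>((2p+1)m\<^sup>2+4mn+3n\<^sup>2+v\<^sub>1m+v\<^sub>2n)/2\<^esup>\<close>. Since \<open>Ac\<^sub>1\<close> and \<open>Ac\<^sub>2\<close>
  are positive multiples of the two unit vectors, the signs in the false theta functions are those of
  the coordinates, and the right-hand side becomes
  \<open>(\<Sum>\<^bsub>m,n\<ge>0\<^esub> T(m,n) - \<Sum>\<^bsub>m,n<0\<^esub> T(m,n)) / (q)\<^sub>\<infinity>\<close>.

  On the left-hand side, iterating the Bailey lemma in base \<open>q\<^sup>a\<close>, \<open>a \<in> {0, 1}\<close>, starting from the unit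
  Bailey pair, evaluates the sum over \<open>s\<^sub>1, \<dots>, s\<^bsub>p-1\<^esub>\<close> with \<open>s\<^sub>p = N\<close> as
  \<open>(q)\<^sub>N \<Sum>\<^sub>r \<alpha>\<^sub>r q\<^bsup>p(r\<^sup>2+ar)\<^esup> / ((q)\<^bsub>N-r\<^esub> (q)\<^bsub>N+r+a\<^esub>)\<close>. For fixed \<open>r\<close> the remaining sum over
  \<open>N = r + j\<close> reduces to series \<open>\<Sum>\<^sub>j q\<^bsup>cj\<^esup> (yq\<^sup>j)\<^sub>j / (q)\<^sub>j\<close>, which the \<open>q\<close>-binomial theorem and Euler's
  identity turn into partial theta series. These are the rows \<open>m = r\<close> and \<open>m = -r-a\<close> of the double sum.
\<close>

section \<open>Finite \<open>q\<close>-identities\<close>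

text \<open>The exponents of the series fix \<open>a\<close>: \<open>s_i^2\<close> (k = 2, 5) means
  a = 0 and \<open>s_i (s_i + 1)\<close> (k = 1, 3, 4) means a = 1. The obstacle is a count of
  factors. The top factor times (q)_N is (q)_{2N+1} for k = 1, (q)_{2N} for k = 3, 4, 5 and (1 -
  q^N) (q)_{2N-1} for k = 2, N > 0; it is divided by (q)_{2r+j+a}, where N = r + j. For k = 1, 5
  exactly j factors survive and form the wanted (y q^j)_j. For k = 2, 3, 4 and j > 0 only j - 1 of
  them survive; a factor of alpha_r must then be split, which yields two partial theta series per r
  instead of one. On the other side, eps runs through Z^2 / L, so the four cosets reassemble Z^2 and
  (-1)^(eps1 + eps2) becomes (-1)^(m+n). The constants e_k come from Q(mu_k) = e_k / (24 (6p-1)) +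
  1/24: the prefactor removes the first summand, eta the second. The excluded pairs come from the
  signs: sgn(m + mu) agrees with the sign of m, 0 counted as positive, only for 0 < mu < 1. All
  infinite sums are unordered, so each exchange rests on a geometric majorant.\<close>

lemma qpoch_0 [simp]: "qpoch q x 0 = 1"
  by (simp add: qpoch_def)

lemma qpoch_Suc: "qpoch q x (Suc n) = qpoch q x n * (1 - x * q ^ n)"
  by (simp add: qpoch_def)

lemma qpoch_add: "qpoch q x (m + n) = qpoch q x m * qpoch q (x * q ^ m) n"
  by (induction n) (simp_all add: qpoch_Suc power_add mult_ac)

lemma qpoch_Suc_left: "qpoch q x (Suc n) = (1 - x) * qpoch q (x * q) n"
  using qpoch_add[of q x 1 n] by (simp add: qpoch_Suc)

text \<open>\<open>qbinom\<close> is meaningless for \<open>k > n\<close> because of the truncated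
  subtraction; extension by 0 lets Pascal's rule cover the boundary \<open>k = n\<close>.\<close>

definition gbinom :: "complex \<Rightarrow> nat \<Rightarrow> nat \<Rightarrow> complex" where
  "gbinom q n k = (if k \<le> n then qbinom q n k else 0)"

context
  fixes q :: complex
  assumes q: "norm q < 1"
begin

lemma power_neq_1: "q ^ Suc n \<noteq> 1"
proof
  assume "q ^ Suc n = 1"
  then have "norm q ^ Suc n = 1" by (metis norm_one norm_power)
  moreover have "norm q ^ Suc n < 1"
    using q power_decreasing[of 1 "Suc n" "norm q"] by simp
  ultimately show False by simp
qed

lemma qpoch_q_nonzero [simp]: "qpoch q q n \<noteq> 0"
proof -
  have "1 - q * q ^ k \<noteq> 0" for k using power_neq_1[of k] by simp
  then show ?thesis by (simp add: qpoch_def)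
qed

lemma gbinom_simps [simp]: "gbinom q n 0 = 1" "gbinom q n n = 1" "k > n \<Longrightarrow> gbinom q n k = 0"
  by (auto simp: gbinom_def qbinom_def)

text \<open>Pascal's rule for q-binomials: the top factor of the numerator splits as 1 - q^(n+1) =
  (1 - q^(n-k)) + q^(n-k) (1 - q^(k+1)), and each part cancels one factor of the
  denominator.\<close>

lemma gbinom_Suc_Suc:
  assumes "k \<le> n"
  shows "gbinom q (Suc n) (Suc k) = gbinom q n (Suc k) + q ^ (n - k) * gbinom q n k"
proof (cases "k = n")
  case False
  define m where "m = n - Suc k"
  have n: "n = Suc (k + m)" using False assms by (simp add: m_def)
  have nz: "1 - q ^ Suc i \<noteq> 0" for i using power_neq_1[of i] by simp
  define K L X where "K = qpoch q q k" and "L = qpoch q q m" and "X = qpoch q q n"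
  define A B where "A = 1 - q ^ Suc k" and "B = 1 - q ^ Suc m"
  have [simp]: "A \<noteq> 0" "B \<noteq> 0" "K \<noteq> 0" "L \<noteq> 0"
    using nz by (simp_all add: A_def B_def K_def L_def)
  have "gbinom q (Suc n) (Suc k) = X * (1 - q ^ Suc n) / ((K * A) * (L * B))"
    using n by (simp add: gbinom_def qbinom_def qpoch_Suc K_def L_def X_def A_def B_def)
  also have "1 - q ^ Suc n = B + q ^ Suc m * A"
    by (simp add: n A_def B_def algebra_simps power_add)
  also have "X * (B + q ^ Suc m * A) / ((K * A) * (L * B))
    = X / ((K * A) * L) + q ^ Suc m * (X / (K * (L * B)))"
    by (simp add: field_simps)
  also have "\<dots> = gbinom q n (Suc k) + q ^ (n - k) * gbinom q n k"
    using n by (simp add: gbinom_def qbinom_def qpoch_Suc K_def L_def X_def A_def B_def)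
  finally show ?thesis .
qed simp

lemma qbinomial_theorem:
  "qpoch q x n = (\<Sum>i\<le>n. (- x) ^ i * q ^ (i choose 2) * gbinom q n i)"
proof (induction n)
  case (Suc n)
  let ?f = "\<lambda>n i. (- x) ^ i * q ^ (i choose 2) * gbinom q n i"
  \<comment> \<open>Pascal's rule contributes q^(n-i) and the binomial exponent q^i. Their product
    q^n does not depend on i, so it factors out as the new factor 1 - x q^n.\<close>
  have *: "?f (Suc n) (Suc i) = ?f n (Suc i) - x * q ^ n * ?f n i" if "i \<le> n" for i
  proof -
    have "q ^ n = q ^ i * q ^ (n - i)" using that by (simp flip: power_add)
    then show ?thesis
      by (simp add: gbinom_Suc_Suc[OF that] numeral_2_eq_2 power_add algebra_simps)
  qed
  have "(\<Sum>i\<le>Suc n. ?f (Suc n) i) = 1 + (\<Sum>i\<le>n. ?f (Suc n) (Suc i))"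
    by (subst sum.atMost_Suc_shift) (simp add: binomial_eq_0)
  also have "\<dots> = 1 + (\<Sum>i\<le>n. ?f n (Suc i)) - x * q ^ n * (\<Sum>i\<le>n. ?f n i)"
    using * by (simp add: sum_subtractf sum_distrib_left)
  also have "1 + (\<Sum>i\<le>n. ?f n (Suc i)) = (\<Sum>i\<le>Suc n. ?f n i)"
    by (subst sum.atMost_Suc_shift) (simp add: binomial_eq_0)
  also have "\<dots> = (\<Sum>i\<le>n. ?f n i)" by simp
  finally have "(\<Sum>i\<le>Suc n. ?f (Suc n) i) = (\<Sum>i\<le>n. ?f n i) - x * q ^ n * (\<Sum>i\<le>n. ?f n i)" .
  then show ?case unfolding qpoch_Suc Suc.IH by (simp only: algebra_simps mult_1_right mult_1_left)
qed (simp add: binomial_eq_0)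

text \<open>The case of the \<open>q\<close>-Vandermonde sum behind the Bailey lemma, with \<open>x\<close> in place of \<open>q\<^bsup>2r+a\<^esup>\<close>.\<close>

lemma q_vandermonde_limit:
  "(\<Sum>j\<le>M. x ^ j * q ^ (j\<^sup>2) * gbinom q M j * qpoch q (x * q ^ Suc j) (M - j)) = 1"
proof (induction M arbitrary: x)
  case (Suc M)
  let ?f = "\<lambda>x M j. x ^ j * q ^ (j\<^sup>2) * gbinom q M j * qpoch q (x * q ^ Suc j) (M - j)"
  let ?g = "\<lambda>j. x ^ j * q ^ (j\<^sup>2) * gbinom q M j * qpoch q (x * q ^ Suc j) (Suc M - j)"
  \<comment> \<open>Pascal's rule splits each term in two. The first parts give the sum for
    \<open>M\<close> times 1 - x q^(M+1); the second give x q^(M+1) times the sum for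
    \<open>M\<close> at \<open>x * q\<close>, which is why \<open>x\<close> is arbitrary in the
    induction. Both sums are 1, so the coefficients add up to 1.\<close>
  have g: "?g j = (1 - x * q ^ Suc M) * ?f x M j" if "j \<le> M" for j
  proof -
    have "q ^ Suc M = q ^ Suc j * q ^ (M - j)" using that by (simp flip: power_add)
    then have "qpoch q (x * q ^ Suc j) (Suc M - j)
      = (1 - x * q ^ Suc M) * qpoch q (x * q ^ Suc j) (M - j)"
      unfolding Suc_diff_le[OF that] qpoch_Suc by (simp only: mult_ac)
    then show ?thesis by simp
  qed
  have s: "?f x (Suc M) (Suc j) = ?g (Suc j) + x * q ^ Suc M * ?f (x * q) M j" if "j \<le> M" for j
  proof -
    have "(Suc j)\<^sup>2 + (M - j) = Suc M + j + j\<^sup>2" using that by (simp add: power2_eq_square)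
    then have e: "q ^ (Suc j)\<^sup>2 * q ^ (M - j) = q ^ Suc M * q ^ j * q ^ (j\<^sup>2)"
      by (metis power_add)
    have "?f x (Suc M) (Suc j) = ?g (Suc j) + x ^ Suc j * (q ^ (Suc j)\<^sup>2 * q ^ (M - j)) * gbinom q M j
        * qpoch q (x * q ^ Suc (Suc j)) (M - j)"
      by (simp add: gbinom_Suc_Suc[OF that] algebra_simps)
    also have "\<dots> = ?g (Suc j) + x * q ^ Suc M * ?f (x * q) M j"
      unfolding e by (simp add: power_mult_distrib mult_ac)
    finally show ?thesis .
  qed
  have "(\<Sum>j\<le>Suc M. ?f x (Suc M) j) = ?g 0 + (\<Sum>j\<le>M. ?f x (Suc M) (Suc j))"
    by (subst sum.atMost_Suc_shift) simp
  also have "\<dots> = ?g 0 + (\<Sum>j\<le>M. ?g (Suc j)) + x * q ^ Suc M * (\<Sum>j\<le>M. ?f (x * q) M j)"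
    using s by (simp add: sum.distrib sum_distrib_left)
  also have "?g 0 + (\<Sum>j\<le>M. ?g (Suc j)) = (\<Sum>j\<le>Suc M. ?g j)"
    by (subst sum.atMost_Suc_shift) simp
  also have "\<dots> = (\<Sum>j\<le>M. ?g j)" by simp
  also have "\<dots> = (1 - x * q ^ Suc M) * (\<Sum>j\<le>M. ?f x M j)"
    unfolding sum_distrib_left using g by (intro sum.cong) auto
  finally show ?case unfolding Suc.IH by simp
qed simp

text \<open>After s = r + j the quotient (q)_{M+b} / (q)_{j+b} is the shifted factorial of
  \<open>q_vandermonde_limit\<close> at x = q^b, so the sum over j collapses to 1.\<close>

lemma bailey_step:
  assumes "r \<le> N"
  shows "(\<Sum>s\<in>{r..N}. q ^ (s * (s + a)) /
      (qpoch q q (N - s) * (qpoch q q (s - r) * qpoch q q (s + r + a))))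
    = q ^ (r * (r + a)) / (qpoch q q (N - r) * qpoch q q (N + r + a))"
proof -
  define M b where "M = N - r" and "b = 2 * r + a"
  have "(\<Sum>s\<in>{r..N}. q ^ (s * (s + a)) /
      (qpoch q q (N - s) * (qpoch q q (s - r) * qpoch q q (s + r + a))))
    = (\<Sum>j\<le>M. q ^ ((j + r) * (j + r + a)) /
      (qpoch q q (M - j) * (qpoch q q j * qpoch q q (j + b))))"
    using assms by (intro sum.reindex_bij_witness[of _ "\<lambda>j. j + r" "\<lambda>s. s - r"])
      (auto simp: M_def b_def algebra_simps)
  also have "\<dots> = (\<Sum>j\<le>M. q ^ (r * (r + a)) / (qpoch q q M * qpoch q q (M + b)) *
      ((q ^ b) ^ j * q ^ (j\<^sup>2) * gbinom q M j * qpoch q (q ^ b * q ^ Suc j) (M - j)))"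
  proof (intro sum.cong refl)
    fix j assume "j \<in> {..M}"
    then have j: "j \<le> M" by simp
    \<comment> \<open>The exponent expands as r (r + a) + b j + j^2 with b = 2r + a.\<close>
    have e: "q ^ ((j + r) * (j + r + a)) = q ^ (r * (r + a)) * ((q ^ b) ^ j * q ^ (j\<^sup>2))"
      unfolding b_def by (simp flip: power_add power_mult) (simp add: power2_eq_square algebra_simps mult_2_right)
    have "M + b = (j + b) + (M - j)" using j by simp
    then have "qpoch q q (M + b) = qpoch q q (j + b) * qpoch q (q * q ^ (j + b)) (M - j)"
      by (metis qpoch_add)
    then have p: "qpoch q (q ^ b * q ^ Suc j) (M - j) = qpoch q q (M + b) / qpoch q q (j + b)"
      by (simp add: power_add mult_ac)
    show "q ^ ((j + r) * (j + r + a)) / (qpoch q q (M - j) * (qpoch q q j * qpoch q q (j + b)))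
      = q ^ (r * (r + a)) / (qpoch q q M * qpoch q q (M + b)) *
      ((q ^ b) ^ j * q ^ (j\<^sup>2) * gbinom q M j * qpoch q (q ^ b * q ^ Suc j) (M - j))"
      unfolding e p using j by (simp add: gbinom_def qbinom_def)
  qed
  also have "\<dots> = q ^ (r * (r + a)) / (qpoch q q M * qpoch q q (M + b))"
    by (subst sum_distrib_left[symmetric]) (simp only: q_vandermonde_limit mult_1_right)
  finally show ?thesis using assms by (simp add: M_def b_def algebra_simps)
qed

end

section \<open>The Bailey lemma along chains\<close>

text \<open>The alpha-side of the unit Bailey pair relative to q^a. For \<open>a = 1\<close> the
  customary 1 / (1 - q) is absorbed by writing the denominators as (q)_{N+r+1} instead of
  (q^2)_{N+r}. At \<open>a = 0\<close>, \<open>r = 0\<close> the general formula would give 2, hence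
  the separate value.\<close>

definition bailey_alpha :: "nat \<Rightarrow> complex \<Rightarrow> nat \<Rightarrow> complex" where
  "bailey_alpha a q r = (if a = 0 \<and> r = 0 then 1
     else (-1) ^ r * q ^ (r choose 2) * (if a = 0 then 1 + q ^ r else 1 - q ^ (2 * r + 1)))"

definition chain_fiber :: "nat \<Rightarrow> nat \<Rightarrow> (nat \<Rightarrow> nat) set" where
  "chain_fiber p N = {s \<in> chains p. s p = N}"

text \<open>Generic in the weight and its semiring: it is used both for the complex weights and, in
  estimates, for their real norms.\<close>

definition chain_sum :: "(nat \<Rightarrow> nat \<Rightarrow> 'a) \<Rightarrow> nat \<Rightarrow> nat \<Rightarrow> 'a :: comm_semiring_1" where
  "chain_sum w p N = (\<Sum>s\<in>chain_fiber p N. \<Prod>i\<in>{1..<p}. w (s (i + 1)) (s i))"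

lemma chain_fiber_1: "chain_fiber 1 N = {\<lambda>i. if i = 1 then N else undefined}"
  by (auto simp: chain_fiber_def chains_def PiE_def extensional_def)

lemma chain_fiber_Suc:
  assumes "p \<ge> 1"
  shows "chain_fiber (Suc p) N = (\<Union>n\<le>N. (\<lambda>s. s(Suc p := N)) ` chain_fiber p n)"
proof (intro equalityI subsetI)
  fix s assume s: "s \<in> chain_fiber (Suc p) N"
  define s' where "s' = s(Suc p := undefined)"
  have "s' \<in> chain_fiber p (s p)"
    using s assms by (auto simp: s'_def chain_fiber_def chains_def PiE_def extensional_def)
  moreover have "s p \<le> N" using s assms by (auto simp: chain_fiber_def chains_def)
  moreover have "s = s'(Suc p := N)" using s by (auto simp: s'_def chain_fiber_def)
  ultimately show "s \<in> (\<Union>n\<le>N. (\<lambda>s. s(Suc p := N)) ` chain_fiber p n)" by blast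
next
  fix s assume "s \<in> (\<Union>n\<le>N. (\<lambda>s. s(Suc p := N)) ` chain_fiber p n)"
  then obtain s' where "s' p \<le> N" "s' \<in> chains p" "s = s'(Suc p := N)"
    by (auto simp: chain_fiber_def)
  then show "s \<in> chain_fiber (Suc p) N"
    using assms less_Suc_eq by (auto simp: chain_fiber_def chains_def PiE_def extensional_def)
qed

lemma finite_chain_fiber: "p \<ge> 1 \<Longrightarrow> finite (chain_fiber p N)"
proof (induction p arbitrary: N rule: nat_induct_at_least)
  case base
  then show ?case unfolding chain_fiber_1 by simp
next
  case (Suc p)
  then show ?case by (simp add: chain_fiber_Suc)
qed

lemma chain_sum_1: "chain_sum w 1 N = 1"
  unfolding chain_sum_def chain_fiber_1 by simp

lemma chain_sum_Suc:
  assumes "p \<ge> 1"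
  shows "chain_sum w (Suc p) N = (\<Sum>n\<le>N. w N n * chain_sum w p n)"
proof -
  let ?g = "\<lambda>s::nat\<Rightarrow>nat. \<Prod>i\<in>{1..<Suc p}. w (s (i + 1)) (s i)"
  let ?u = "\<lambda>s::nat\<Rightarrow>nat. s(Suc p := N)"
  \<comment> \<open>Members of a fiber are undefined at \<open>Suc p\<close>, so filling in that
    entry forgets nothing and is injective. Images of different fibers stay apart because the entry
    at \<open>p\<close> survives.\<close>
  have u: "s (Suc p) = undefined" if "s \<in> chain_fiber p n" for s n
    using that by (auto simp: chain_fiber_def chains_def PiE_def extensional_def)
  have inj: "inj_on ?u (chain_fiber p n)" for n
    by (intro inj_onI) (metis u fun_upd_triv fun_upd_upd)
  have disj: "?u ` chain_fiber p m \<inter> ?u ` chain_fiber p n = {}" if "m \<noteq> n" for m n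
  proof -
    have "?u s \<noteq> ?u t" if "s \<in> chain_fiber p m" "t \<in> chain_fiber p n" for s t
    proof
      assume "?u s = ?u t"
      then have "?u s p = ?u t p" by (rule fun_cong)
      then show False using that \<open>m \<noteq> n\<close> by (simp add: chain_fiber_def)
    qed
    then show ?thesis by blast
  qed
  have "chain_sum w (Suc p) N = (\<Sum>n\<le>N. \<Sum>s\<in>?u ` chain_fiber p n. ?g s)"
    unfolding chain_sum_def chain_fiber_Suc[OF assms]
    by (rule sum.UNION_disjoint) (use finite_chain_fiber[OF assms] disj in auto)
  also have "\<dots> = (\<Sum>n\<le>N. \<Sum>s\<in>chain_fiber p n. ?g (?u s))"
    by (simp only: sum.reindex[OF inj] o_def)
  also have "\<dots> = (\<Sum>n\<le>N. \<Sum>s\<in>chain_fiber p n. w N n * (\<Prod>i\<in>{1..<p}. w (s (i + 1)) (s i)))"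
  proof (intro sum.cong refl)
    fix n s assume s: "s \<in> chain_fiber p n"
    have "?g (?u s) = (\<Prod>i\<in>{1..<p}. w (?u s (i + 1)) (?u s i)) * w N n"
      using s assms by (simp add: chain_fiber_def)
    also have "(\<Prod>i\<in>{1..<p}. w (?u s (i + 1)) (?u s i)) = (\<Prod>i\<in>{1..<p}. w (s (i + 1)) (s i))"
      by (intro prod.cong) auto
    finally show "?g (?u s) = w N n * (\<Prod>i\<in>{1..<p}. w (s (i + 1)) (s i))"
      by (simp add: mult.commute)
  qed
  finally show ?thesis by (simp add: chain_sum_def sum_distrib_left)
qed

context
  fixes q :: complex
  assumes q: "norm q < 1"
begin

text \<open>The sum of the unit Bailey pair telescopes; the factor \<open>1 - q\<^bsup>N-R\<^esup>\<close> on the right cancels one factor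
  of \<open>(q)\<^bsub>N-R\<^esub>\<close> and makes the formula valid up to \<open>R = N\<close>.\<close>

lemma unit_bailey_partial_sum:
  assumes "a \<le> 1" "N \<ge> 1" "R \<le> N"
  shows "(1 - q ^ N) * (\<Sum>r\<le>R. bailey_alpha a q r / (qpoch q q (N - r) * qpoch q q (N + r + a)))
    = (-1) ^ R * q ^ (Suc R choose 2) * (if a = 0 then 1 else 1 - q ^ Suc R) * (1 - q ^ (N - R))
      / (qpoch q q (N - R) * qpoch q q (N + R + a))"
  using assms(3)
proof (induction R)
  case 0
  show ?case using assms(1) by (auto simp: bailey_alpha_def numeral_2_eq_2)
next
  case (Suc R)
  let ?c = "\<lambda>R. if a = 0 then 1 else 1 - q ^ Suc R"
  let ?b = "if a = 0 then 1 + q ^ Suc R else 1 - q ^ (2 * Suc R + 1)"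
  define M where "M = N - Suc R"
  have N: "N = Suc (R + M)" "N - R = Suc M" using Suc.prems by (auto simp: M_def)
  define D E s where "D = qpoch q q M" and "E = qpoch q q (N + R + a)"
    and "s = (-1) ^ R * q ^ (Suc R choose 2)"
  have nz: "1 - q ^ Suc i \<noteq> 0" for i using power_neq_1[OF q, of i] by simp
  have [simp]: "D \<noteq> 0" "E \<noteq> 0" using qpoch_q_nonzero[OF q] by (simp_all add: D_def E_def)
  define F where "F = 1 - q ^ Suc (N + R + a)"
  have [simp]: "F \<noteq> 0" unfolding F_def by (rule nz)
  have E': "qpoch q q (N + Suc R + a) = E * F" by (simp add: E_def F_def qpoch_Suc)
  \<comment> \<open>Over the common denominator \<open>D * (E * F)\<close> this polynomial identity
    is all that the induction step requires.\<close>
  have id: "?c R * F - (1 - q ^ N) * ?b = - (q ^ Suc R * ?c (Suc R) * (1 - q ^ M))"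
  proof (cases "a = 0")
    case True
    then show ?thesis by (simp add: F_def N power_add algebra_simps)
  next
    case False
    then have "a = 1" using assms(1) by simp
    then show ?thesis by (simp add: F_def N power_add mult_2 mult_2_right algebra_simps)
  qed
  have "(1 - q ^ N) * (\<Sum>r\<le>Suc R. bailey_alpha a q r / (qpoch q q (N - r) * qpoch q q (N + r + a)))
    = s * ?c R * (1 - q ^ Suc M) / (qpoch q q (Suc M) * E)
      + (1 - q ^ N) * (bailey_alpha a q (Suc R) / (D * (E * F)))"
    unfolding sum.atMost_Suc distrib_left using Suc.IH Suc.prems
    by (simp only: N(2) E' D_def E_def s_def M_def)
  also have "qpoch q q (Suc M) = D * (1 - q ^ Suc M)" by (simp add: D_def qpoch_Suc)
  also have "s * ?c R * (1 - q ^ Suc M) / (D * (1 - q ^ Suc M) * E) = s * ?c R * F / (D * (E * F))"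
    using nz[of M] by (simp add: field_simps)
  also have "bailey_alpha a q (Suc R) = - s * ?b" by (simp add: bailey_alpha_def s_def)
  also have "s * ?c R * F / (D * (E * F)) + (1 - q ^ N) * (- s * ?b / (D * (E * F)))
    = s * (?c R * F - (1 - q ^ N) * ?b) / (D * (E * F))"
    by (simp only: diff_divide_distrib right_diff_distrib) (simp add: algebra_simps)
  also have "\<dots> = - s * q ^ Suc R * ?c (Suc R) * (1 - q ^ M) / (D * (E * F))"
    unfolding id by (simp add: algebra_simps)
  also have "- s * q ^ Suc R = (-1) ^ Suc R * q ^ (Suc (Suc R) choose 2)"
    by (simp add: s_def numeral_2_eq_2 power_add)
  finally show ?case unfolding E' M_def[symmetric] D_def .
qed

text \<open>At R = N the partial sum formula has the factor 1 - q^0 = 0 on the right, while 1 - q^N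
  is nonzero for N > 0. For N = 0 that factor vanishes too, so this case is computed
  directly.\<close>

lemma unit_bailey_pair:
  assumes "a \<le> 1"
  shows "(\<Sum>r\<le>N. bailey_alpha a q r / (qpoch q q (N - r) * qpoch q q (N + r + a)))
    = (if N = 0 then 1 else 0)"
proof (cases N)
  case 0
  have "1 - q \<noteq> 0" using power_neq_1[OF q, of 0] by simp
  moreover have "a = 0 \<or> a = 1" using assms by auto
  ultimately show ?thesis using 0 by (auto simp: bailey_alpha_def qpoch_Suc numeral_2_eq_2)
next
  case (Suc n)
  then show ?thesis
    using unit_bailey_partial_sum[OF assms, of N N] power_neq_1[OF q, of n] by simp
qed

text \<open>Here \<open>P s\<close> is (q)_s times the beta-side of a Bailey pair, so (q)_s cancels
  against the q-binomial. Exchanging the triangular sum leaves \<open>bailey_step\<close> for each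
  r. The result has the shape of the hypothesis with \<open>A r\<close> multiplied by q^(r(r+a)), so
  the lemma can be iterated.\<close>

lemma bailey_lemma:
  assumes P: "\<And>s. P s = qpoch q q s *
      (\<Sum>r\<le>s. A r / (qpoch q q (s - r) * qpoch q q (s + r + a)))"
  shows "(\<Sum>s\<le>N. q ^ (s * (s + a)) * qbinom q N s * P s) = qpoch q q N *
      (\<Sum>r\<le>N. A r * q ^ (r * (r + a)) / (qpoch q q (N - r) * qpoch q q (N + r + a)))"
proof -
  have "(\<Sum>s\<le>N. q ^ (s * (s + a)) * qbinom q N s * P s)
    = (\<Sum>s\<le>N. \<Sum>r\<le>s. qpoch q q N * (A r * (q ^ (s * (s + a)) /
      (qpoch q q (N - s) * (qpoch q q (s - r) * qpoch q q (s + r + a))))))"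
    unfolding P sum_distrib_left
    by (intro sum.cong refl) (simp add: qbinom_def qpoch_q_nonzero[OF q])
  also have "\<dots> = (\<Sum>r\<le>N. \<Sum>s\<in>{r..N}. qpoch q q N * (A r * (q ^ (s * (s + a)) /
      (qpoch q q (N - s) * (qpoch q q (s - r) * qpoch q q (s + r + a))))))"
    by (subst sum.Sigma, simp, simp, subst sum.Sigma, simp, simp)
      (intro sum.reindex_bij_witness[of _ prod.swap prod.swap]; auto)
  also have "\<dots> = (\<Sum>r\<le>N. qpoch q q N * (A r * (q ^ (r * (r + a)) /
      (qpoch q q (N - r) * qpoch q q (N + r + a)))))"
    by (intro sum.cong refl, unfold sum_distrib_left[symmetric], subst bailey_step[OF q]) auto
  finally show ?thesis by (simp add: sum_distrib_left)
qed

lemma chain_sum_bailey: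
  assumes a: "a \<le> 1" and "p \<ge> 1"
  shows "chain_sum (\<lambda>N s. q ^ (s * (s + a)) * qbinom q N s) p N = qpoch q q N *
    (\<Sum>r\<le>N. bailey_alpha a q r * q ^ (p * (r * (r + a))) /
      (qpoch q q (N - r) * qpoch q q (N + r + a)))"
  using \<open>p \<ge> 1\<close>
proof (induction p arbitrary: N rule: nat_induct_at_least)
  case base
  \<comment> \<open>Even \<open>p = 1\<close> uses one Bailey step: the empty chain product 1 is the
    left side of the lemma for the unit pair, whose beta is concentrated at s = 0. Hence p steps for
    p - 1 summations.\<close>
  have "1 = (\<Sum>s\<le>N. if s = 0 then 1 else 0 :: complex)" by simp
  also have "\<dots> = (\<Sum>s\<le>N. q ^ (s * (s + a)) * qbinom q N s * (if s = 0 then 1 else 0))"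
    by (intro sum.cong refl) (auto simp: qbinom_def qpoch_q_nonzero[OF q])
  also have "\<dots> = qpoch q q N * (\<Sum>r\<le>N. bailey_alpha a q r * q ^ (r * (r + a)) /
      (qpoch q q (N - r) * qpoch q q (N + r + a)))"
    by (rule bailey_lemma) (use unit_bailey_pair[OF a] in auto)
  finally show ?case unfolding chain_sum_1 by simp
next
  case (Suc p)
  have "chain_sum (\<lambda>N s. q ^ (s * (s + a)) * qbinom q N s) (Suc p) N = (\<Sum>s\<le>N. q ^ (s * (s + a)) *
    qbinom q N s * chain_sum (\<lambda>N s. q ^ (s * (s + a)) * qbinom q N s) p s)"
    by (rule chain_sum_Suc) fact
  also have "\<dots> = qpoch q q N * (\<Sum>r\<le>N. bailey_alpha a q r * q ^ (p * (r * (r + a))) *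
      q ^ (r * (r + a)) / (qpoch q q (N - r) * qpoch q q (N + r + a)))"
    by (rule bailey_lemma) (rule Suc.IH)
  finally show ?case by (simp add: power_add ring_distribs mult_ac)
qed

end

section \<open>Partial theta series\<close>

lemma has_sum_Suc_iff:
  fixes f :: "nat \<Rightarrow> complex"
  shows "((\<lambda>n. f (Suc n)) has_sum S) UNIV \<longleftrightarrow> (f has_sum (f 0 + S)) UNIV"
proof -
  have "((\<lambda>n. f (Suc n)) has_sum S) UNIV \<longleftrightarrow> (f has_sum S) (range Suc)"
    using has_sum_reindex[of Suc UNIV f S] by (simp add: o_def)
  moreover have "(f has_sum (f 0 + S)) UNIV \<longleftrightarrow> (f has_sum S) (range Suc)"
  proof
    assume *: "(f has_sum (f 0 + S)) UNIV"
    have "f summable_on range Suc"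
      by (rule summable_on_subset_banach[of f UNIV]) (use * in \<open>auto simp: summable_on_def\<close>)
    then obtain T where T: "(f has_sum T) (range Suc)" by (auto simp: summable_on_def)
    have "(f has_sum (f 0 + T)) (insert 0 (range Suc))"
      by (rule has_sum_insert) (use T in auto)
    then have "f 0 + T = f 0 + S" using * has_sum_unique by (metis UNIV_nat_eq)
    then show "(f has_sum S) (range Suc)" using T by simp
  next
    assume "(f has_sum S) (range Suc)"
    then have "(f has_sum (f 0 + S)) (insert 0 (range Suc))"
      by (intro has_sum_insert) auto
    then show "(f has_sum (f 0 + S)) UNIV" by (metis UNIV_nat_eq)
  qed
  ultimately show ?thesis by simp
qed

lemma summable_on_product_real:
  fixes f :: "'a \<Rightarrow> real" and g :: "'b \<Rightarrow> real"
  assumes "f summable_on A" "g summable_on B"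
    and "\<And>x. x \<in> A \<Longrightarrow> f x \<ge> 0" "\<And>y. y \<in> B \<Longrightarrow> g y \<ge> 0"
  shows "(\<lambda>(x, y). f x * g y) summable_on A \<times> B"
proof (rule summable_on_SigmaI)
  fix x assume "x \<in> A"
  show "((\<lambda>y. case (x, y) of (x, y) \<Rightarrow> f x * g y) has_sum f x * infsum g B) B"
    using assms(2) by (simp add: has_sum_cmult_right)
qed (use assms in \<open>auto intro: summable_on_cmult_left\<close>)

lemma geometric_summable_on:
  fixes r :: real
  assumes "0 \<le> r" "r < 1"
  shows "(\<lambda>n. r ^ n) summable_on UNIV"
  using assms by (simp add: summable_on_UNIV_nonneg_real_iff)

lemma complex_summable_on_comparison:
  fixes f :: "'a \<Rightarrow> complex"
  assumes "g summable_on A" and "\<And>x. x \<in> A \<Longrightarrow> norm (f x) \<le> g x"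
  shows "f summable_on A"
  using Infinite_Sum.abs_summable_on_comparison_test'[OF assms] by (rule abs_summable_summable)

text \<open>A geometric majorant in i + l makes the family absolutely summable, so summing along
  diagonals N = i + l agrees with summing row by row. It serves both the q-binomial expansion and
  the exchange of N with the Bailey index r.\<close>

lemma triangle_sum:
  fixes f :: "nat \<Rightarrow> nat \<Rightarrow> complex"
  assumes r: "0 \<le> r" "r < 1" and f: "\<And>i l. norm (f i l) \<le> C * r ^ (i + l)"
  shows "(\<lambda>(i, l). f i l) summable_on UNIV"
    and "((\<lambda>N. \<Sum>i\<le>N. f i (N - i)) has_sum (\<Sum>\<^sub>\<infinity>i. \<Sum>\<^sub>\<infinity>l. f i l)) UNIV"
proof -
  have "(\<lambda>(i, l). r ^ i * r ^ l) summable_on (UNIV :: nat set) \<times> (UNIV :: nat set)"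
    using r by (intro summable_on_product_real geometric_summable_on) auto
  then have "(\<lambda>il. C * (case il of (i, l) \<Rightarrow> r ^ i * r ^ l)) summable_on (UNIV :: (nat \<times> nat) set)"
    by (intro summable_on_cmult_right) simp
  then show *: "(\<lambda>(i, l). f i l) summable_on UNIV"
    by (rule complex_summable_on_comparison) (use f in \<open>auto simp: power_add\<close>)
  let ?h = "\<lambda>(N, i). (i, N - i)"
  have bij: "bij_betw ?h (SIGMA N:UNIV. {..N}) (UNIV :: (nat \<times> nat) set)"
    by (rule bij_betwI[of _ _ _ "\<lambda>(i, l). (i + l, i)"]) auto
  have sum: "(\<lambda>(N, i). f i (N - i)) summable_on (SIGMA N:UNIV. {..N})"
    using * summable_on_reindex_bij_betw[OF bij, of "\<lambda>(i, l). f i l"] by (simp add: case_prod_unfold)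
  have "(\<Sum>\<^sub>\<infinity>i. \<Sum>\<^sub>\<infinity>l. f i l) = (\<Sum>\<^sub>\<infinity>(i, l)\<in>UNIV. f i l)"
    using infsum_Sigma'_banach[of f UNIV "\<lambda>_. UNIV"] * by simp
  also have "\<dots> = (\<Sum>\<^sub>\<infinity>(N, i)\<in>(SIGMA N:UNIV. {..N}). f i (N - i))"
    using infsum_reindex_bij_betw[OF bij, of "\<lambda>(i, l). f i l"] by (simp add: case_prod_unfold)
  also have "\<dots> = (\<Sum>\<^sub>\<infinity>N. \<Sum>i\<le>N. f i (N - i))"
    using infsum_Sigma'_banach[OF sum] by simp
  finally show "((\<lambda>N. \<Sum>i\<le>N. f i (N - i)) has_sum (\<Sum>\<^sub>\<infinity>i. \<Sum>\<^sub>\<infinity>l. f i l)) UNIV"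
    using summable_on_Sigma_banach[OF sum] by (simp add: has_sum_infsum)
qed

lemma summable_poly_geometric:
  fixes r :: real
  assumes "0 \<le> r" "r < 1"
  shows "summable (\<lambda>n. r ^ n * real (n + 1) ^ p)"
proof (cases "r = 0")
  case False
  \<comment> \<open>The midpoint of r and 1 leaves room for the polynomial's ratio, which tends to
    1.\<close>
  define c where "c = (1 + r) / 2"
  have c: "c < 1" "r < c" using assms by (auto simp: c_def)
  have "(\<lambda>n. (1 + 1 / real (Suc n)) ^ p * r) \<longlonglongrightarrow> (1 + 0) ^ p * r"
    by (intro tendsto_intros LIMSEQ_Suc[OF lim_1_over_n])
  then have "eventually (\<lambda>n. (1 + 1 / real (Suc n)) ^ p * r < c) sequentially"
    using c by (intro order_tendstoD) auto
  then obtain N where N: "\<And>n. n \<ge> N \<Longrightarrow> (1 + 1 / real (Suc n)) ^ p * r < c"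
    by (auto simp: eventually_sequentially)
  show ?thesis
  proof (rule summable_ratio_test[OF c(1)])
    fix n assume "n \<ge> N"
    have e: "real (Suc n + 1) = (1 + 1 / real (Suc n)) * real (n + 1)"
      by (simp add: field_simps)
    have "r ^ Suc n * real (Suc n + 1) ^ p = ((1 + 1 / real (Suc n)) ^ p * r) * (r ^ n * real (n + 1) ^ p)"
      unfolding e power_mult_distrib by simp
    also have "\<dots> \<le> c * (r ^ n * real (n + 1) ^ p)"
      using N[OF \<open>n \<ge> N\<close>] assms by (intro mult_right_mono) auto
    finally show "norm (r ^ Suc n * real (Suc n + 1) ^ p) \<le> c * norm (r ^ n * real (n + 1) ^ p)"
      using assms by simp
  qed
next
  case True
  then show ?thesis by (intro summable_finite[of "{0}"]) auto
qed

section \<open>Bounds for q-factorials and the sums of Euler and q-binomial type\<close>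

context
  fixes q :: complex
  assumes q: "norm q < 1"
begin

lemma convergent_prod_qpoch: "convergent_prod (\<lambda>k. 1 - q ^ Suc k)"
proof -
  have "summable (\<lambda>k. norm (q ^ Suc k))"
    using q summable_mult[OF summable_geometric[of "norm q"], of "norm q"]
    by (simp add: norm_mult norm_power)
  then have "convergent_prod (\<lambda>k. 1 + - (q ^ Suc k))"
    by (intro summable_imp_convergent_prod_complex) (use power_neq_1[OF q] in auto)
  then show ?thesis by simp
qed

lemma qpoch_inf_nonzero: "qpoch_inf q \<noteq> 0"
  unfolding qpoch_inf_def
  by (rule prodinf_nonzero[OF convergent_prod_qpoch]) (metis eq_iff_diff_eq_0 power_neq_1[OF q])

lemma qpoch_tendsto: "qpoch q q \<longlonglongrightarrow> qpoch_inf q"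
proof -
  have "qpoch q q (Suc n) = (\<Prod>k\<le>n. 1 - q ^ Suc k)" for n
    by (simp add: qpoch_def lessThan_Suc_atMost)
  then have "(\<lambda>n. qpoch q q (Suc n)) \<longlonglongrightarrow> qpoch_inf q"
    unfolding qpoch_inf_def using convergent_prod_LIMSEQ[OF convergent_prod_qpoch] by simp
  then show ?thesis by (rule LIMSEQ_imp_Suc)
qed

text \<open>Each factor is at most 1 + |q|^k, hence at most exp(|q|^k). The bound is uniform in x
  and n, as the majorants below require.\<close>

lemma norm_qpoch_le:
  assumes "norm x \<le> 1"
  shows "norm (qpoch q x n) \<le> exp (1 / (1 - norm q))"
proof -
  have "norm (qpoch q x n) \<le> (\<Prod>k<n. exp (norm q ^ k))"
    unfolding qpoch_def prod_norm[symmetric]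
  proof (intro prod_mono conjI norm_ge_zero)
    fix k
    have "norm (1 - x * q ^ k) \<le> 1 + norm x * norm q ^ k"
      by (metis norm_mult norm_one norm_power norm_triangle_ineq4)
    also have "\<dots> \<le> 1 + norm q ^ k" using assms by (simp add: mult_left_le_one_le)
    also have "\<dots> \<le> exp (norm q ^ k)" by (rule exp_ge_add_one_self)
    finally show "norm (1 - x * q ^ k) \<le> exp (norm q ^ k)" .
  qed
  also have "\<dots> = exp (\<Sum>k<n. norm q ^ k)" by (simp add: exp_sum)
  also have "(\<Sum>k<n. norm q ^ k) \<le> 1 / (1 - norm q)"
    using q sum_le_suminf[of "\<lambda>k. norm q ^ k" "{..<n}"] by (simp add: suminf_geometric)
  finally show ?thesis by simp
qed

lemma inverse_qpoch_bounded:
  obtains C where "C \<ge> 1" "\<And>n. norm (1 / qpoch q q n) \<le> C"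
proof -
  have "(\<lambda>n. 1 / qpoch q q n) \<longlonglongrightarrow> 1 / qpoch_inf q"
    using qpoch_tendsto qpoch_inf_nonzero by (intro tendsto_intros)
  then have "Bseq (\<lambda>n. 1 / qpoch q q n)" by (rule convergent_imp_Bseq[OF convergentI])
  then obtain K where "\<And>n. norm (1 / qpoch q q n) \<le> K" by (auto simp: Bseq_def)
  then show ?thesis by (intro that[of "max K 1"]) (auto simp: le_max_iff_disj)
qed

text \<open>Euler's sum of z^l / (q)_l at z = q^(i+1). Induction on i needs no infinite product
  besides (q)_inf: for i = 0 the partial sums are 1 / (q)_n, and raising i by 1 multiplies the value
  by 1 - q^(i+1).\<close>

lemma euler_sum: "((\<lambda>l. q ^ (l * Suc i) / qpoch q q l) has_sum (qpoch q q i / qpoch_inf q)) UNIV"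
proof (induction i)
  case 0
  have "(\<Sum>l<Suc n. q ^ l / qpoch q q l) = 1 / qpoch q q n" for n
  proof (induction n)
    case (Suc n)
    have nz: "1 - q ^ Suc n \<noteq> 0" using power_neq_1[OF q, of n] by simp
    have "(\<Sum>l<Suc (Suc n). q ^ l / qpoch q q l) = 1 / qpoch q q n + q ^ Suc n / qpoch q q (Suc n)"
      using Suc.IH by simp
    then show ?case using nz qpoch_q_nonzero[OF q, of n]
      by (simp add: qpoch_Suc divide_simps)
  qed simp
  then have "(\<lambda>n. \<Sum>l<Suc n. q ^ l / qpoch q q l) \<longlonglongrightarrow> 1 / qpoch_inf q"
    using qpoch_tendsto qpoch_inf_nonzero by (simp only:) (intro tendsto_intros)
  then have sums: "(\<lambda>l. q ^ l / qpoch q q l) sums (1 / qpoch_inf q)"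
    unfolding sums_def by (rule LIMSEQ_imp_Suc)
  obtain C where C: "C \<ge> 1" "\<And>n. norm (1 / qpoch q q n) \<le> C" by (rule inverse_qpoch_bounded) auto
  have "summable (\<lambda>l. norm (q ^ l / qpoch q q l))"
  proof (rule summable_comparison_test')
    show "summable (\<lambda>l. C * norm q ^ l)"
      using q by (intro summable_mult summable_geometric) simp
    show "norm (norm (q ^ l / qpoch q q l)) \<le> C * norm q ^ l" for l
      using mult_right_mono[OF C(2)[of l], of "norm q ^ l"] by (simp add: norm_divide norm_power)
  qed
  from norm_summable_imp_has_sum[OF this sums] show ?case by simp
next
  case (Suc i)
  let ?S = "qpoch q q i / qpoch_inf q"
  \<comment> \<open>The factor 1 - q^l kills l = 0 and lowers (q)_l to (q)_{l-1}; after the index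
    shift this is q^(i+1) times the old series.\<close>
  let ?g = "\<lambda>l. q ^ (l * Suc i) * (1 - q ^ l) / qpoch q q l"
  have "?g (Suc l) = q ^ Suc i * (q ^ (l * Suc i) / qpoch q q l)" for l
    using power_neq_1[OF q, of l] by (simp add: qpoch_Suc power_add)
  then have "((\<lambda>l. ?g (Suc l)) has_sum q ^ Suc i * ?S) UNIV"
    by (simp only:) (rule has_sum_cmult_right[OF Suc.IH])
  then have "(?g has_sum q ^ Suc i * ?S) UNIV"
    using has_sum_Suc_iff[of ?g "q ^ Suc i * ?S"] by simp
  then have "((\<lambda>l. q ^ (l * Suc i) / qpoch q q l + - ?g l) has_sum (?S + - (q ^ Suc i * ?S))) UNIV"
    by (intro has_sum_add Suc.IH has_sum_uminusI)
  moreover have "q ^ (l * Suc i) / qpoch q q l + - ?g l = q ^ (l * Suc (Suc i)) / qpoch q q l" for l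
    by (simp add: power_add right_diff_distrib diff_divide_distrib)
  moreover have "?S + - (q ^ Suc i * ?S) = qpoch q q (Suc i) / qpoch_inf q"
    by (simp add: qpoch_Suc algebra_simps diff_divide_distrib)
  ultimately show ?case by simp
qed

text \<open>Expand (y q^j)_j by the q-binomial theorem, put l = j - i and sum over l by Euler at
  q^(i+d+1). What remains of the factorials is (q)_{i+d} / (q)_i = (q^(i+1))_d. Only the factor q^(2
  s_p) of k = 3 calls for d = 1; otherwise d = 0.\<close>

lemma qpoch_geometric_sum:
  fixes d :: nat
  defines "t \<equiv> \<lambda>y i. (- y) ^ i * q ^ ((i choose 2) + i\<^sup>2 + Suc d * i) * qpoch q (q ^ Suc i) d"
  assumes y: "norm y \<le> 1"
  shows "t y summable_on UNIV"
    and "((\<lambda>j. q ^ (Suc d * j) * qpoch q (y * q ^ j) j / qpoch q q j) has_sum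
           ((\<Sum>\<^sub>\<infinity>i. t y i) / qpoch_inf q)) UNIV"
proof -
  \<comment> \<open>The total power of q in the i-th expanded term, with j = i + l. It is at least i
    + l, which supplies the geometric majorant.\<close>
  let ?e = "\<lambda>i l. Suc d * (i + l) + i * (i + l) + (i choose 2)"
  define f where "f = (\<lambda>i l. (- y) ^ i * q ^ ?e i l / (qpoch q q i * qpoch q q l))"
  obtain C where C: "C \<ge> 1" "\<And>n. norm (1 / qpoch q q n) \<le> C" by (rule inverse_qpoch_bounded) auto
  have bound: "norm (f i l) \<le> C * C * norm q ^ (i + l)" for i l
  proof -
    have "norm (f i l) = norm y ^ i * norm q ^ ?e i l * (norm (1 / qpoch q q i) * norm (1 / qpoch q q l))"
      by (simp add: f_def norm_mult norm_power norm_divide)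
    also have "\<dots> \<le> (1 * norm q ^ (i + l)) * (C * C)"
      using C y q by (intro mult_mono power_le_one power_decreasing) (auto simp: norm_mult)
    finally show ?thesis by (simp only: mult_ac mult_1)
  qed
  have inner: "(f i has_sum t y i / qpoch_inf q) UNIV" for i
  proof -
    have "f i = (\<lambda>l. (- y) ^ i * q ^ ((i choose 2) + i\<^sup>2 + Suc d * i) / qpoch q q i
        * (q ^ (l * Suc (i + d)) / qpoch q q l))"
      by (simp add: f_def fun_eq_iff flip: power_add) (simp add: power2_eq_square algebra_simps)
    moreover have "t y i / qpoch_inf q = (- y) ^ i * q ^ ((i choose 2) + i\<^sup>2 + Suc d * i) / qpoch q q i
        * (qpoch q q (i + d) / qpoch_inf q)"
      using qpoch_q_nonzero[OF q] by (simp add: t_def qpoch_add)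
    ultimately show ?thesis by (simp only:) (intro has_sum_cmult_right euler_sum)
  qed
  have sum: "(\<lambda>(i, l). f i l) summable_on UNIV \<times> UNIV"
    using triangle_sum(1)[OF norm_ge_zero q bound] by simp
  have "(\<lambda>i. infsum (f i) UNIV) summable_on UNIV"
    using summable_on_Sigma_banach[OF sum] by simp
  then have "(\<lambda>i. t y i / qpoch_inf q) summable_on UNIV"
    by (simp only: infsumI[OF inner])
  from summable_on_cmult_left[OF this, of "qpoch_inf q"] show "t y summable_on UNIV"
    using qpoch_inf_nonzero by simp
  have "(\<Sum>i\<le>j. f i (j - i)) = q ^ (Suc d * j) * qpoch q (y * q ^ j) j / qpoch q q j" for j
    unfolding qbinomial_theorem[OF q, of "y * q ^ j"] sum_distrib_left sum_divide_distrib
  proof (intro sum.cong refl)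
    fix i assume "i \<in> {..j}"
    then have "i \<le> j" by simp
    have e: "(- (y * q ^ j)) ^ i = (- y) ^ i * q ^ (i * j)"
      by (metis minus_mult_left mult.commute power_mult power_mult_distrib)
    have "f i (j - i) = (- y) ^ i * q ^ (Suc d * j + i * j + (i choose 2)) / (qpoch q q i * qpoch q q (j - i))"
      using \<open>i \<le> j\<close> by (simp only: f_def le_add_diff_inverse)
    then show "f i (j - i) = q ^ (Suc d * j) * ((- (y * q ^ j)) ^ i * q ^ (i choose 2) * gbinom q j i) / qpoch q q j"
      unfolding e using \<open>i \<le> j\<close> qpoch_q_nonzero[OF q] by (simp add: gbinom_def qbinom_def power_add)
  qed
  then show "((\<lambda>j. q ^ (Suc d * j) * qpoch q (y * q ^ j) j / qpoch q q j) has_sum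
           ((\<Sum>\<^sub>\<infinity>i. t y i) / qpoch_inf q)) UNIV"
    using triangle_sum(2)[OF norm_ge_zero q bound]
    by (simp add: infsumI[OF inner] infsum_cmult_left' divide_inverse)
qed

end

section \<open>Interchanging the Habiro-type sums\<close>

text \<open>A crude count: each summation has at most N + 1 terms and adds one weight. Polynomial
  growth in N suffices against the geometric decay of the top factor.\<close>

lemma chain_sum_le:
  fixes w :: "nat \<Rightarrow> nat \<Rightarrow> real"
  assumes "p \<ge> 1" "B \<ge> 1" "\<And>N n. n \<le> N \<Longrightarrow> w N n \<le> B" "\<And>N n. n \<le> N \<Longrightarrow> 0 \<le> w N n"
  shows "chain_sum w p N \<le> B ^ p * real (N + 1) ^ p"
  using \<open>p \<ge> 1\<close>
proof (induction p arbitrary: N rule: nat_induct_at_least)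
  case base
  have "1 * 1 \<le> B * real (N + 1)" using assms(2) by (intro mult_mono) auto
  then show ?case unfolding chain_sum_1 by simp
next
  case (Suc p)
  have "(\<Sum>n\<le>N. w N n * chain_sum w p n) \<le> (\<Sum>n\<le>N. B * (B ^ p * real (N + 1) ^ p))"
  proof (intro sum_mono)
    fix n assume n: "n \<in> {..N}"
    have "chain_sum w p n \<le> B ^ p * real (n + 1) ^ p" by (rule Suc.IH)
    also have "\<dots> \<le> B ^ p * real (N + 1) ^ p"
      using n assms(2) by (intro mult_left_mono power_mono) auto
    finally have *: "chain_sum w p n \<le> B ^ p * real (N + 1) ^ p" .
    have "w N n * chain_sum w p n \<le> w N n * (B ^ p * real (N + 1) ^ p)"
      using n assms(4) * by (intro mult_left_mono) auto
    also have "\<dots> \<le> B * (B ^ p * real (N + 1) ^ p)"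
      using n assms(2,3) by (intro mult_right_mono) auto
    finally show "w N n * chain_sum w p n \<le> B * (B ^ p * real (N + 1) ^ p)" .
  qed
  also have "\<dots> = B ^ Suc p * real (N + 1) ^ Suc p" by (simp add: algebra_simps)
  finally show ?case using Suc.hyps by (simp add: chain_sum_Suc)
qed

context
  fixes q :: complex
  assumes q: "norm q < 1"
begin

text \<open>Chains are fibered over their top entry N. The weights are uniformly bounded, so the
  norms on a fiber add up to at most a constant times |q|^N (N+1)^p; this gives absolute summability
  and allows summation fiber by fiber.\<close>

lemma infsum_chains:
  fixes a :: nat
  assumes p: "p \<ge> 1" and D: "\<And>N. norm (D N) \<le> K * norm q ^ N"
  defines "w \<equiv> \<lambda>N n. q ^ (n * (n + a)) * qbinom q N n"
  shows "(\<Sum>\<^sub>\<infinity>s\<in>chains p. D (s p) * (\<Prod>i\<in>{1..<p}. w (s (i + 1)) (s i)))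
    = (\<Sum>\<^sub>\<infinity>N. D N * chain_sum w p N)"
proof -
  obtain C where C: "C \<ge> 1" "\<And>n. norm (1 / qpoch q q n) \<le> C"
    by (rule inverse_qpoch_bounded[OF q]) auto
  define B where "B = exp (1 / (1 - norm q)) * C * C"
  have q0: "0 \<le> 1 / (1 - norm q)" using q by simp
  have B: "B \<ge> 1"
  proof -
    have "1 * 1 * 1 \<le> B" unfolding B_def using C(1) q0 by (intro mult_mono) auto
    then show ?thesis by simp
  qed
  have wB: "norm (w N n) \<le> B" for N n
  proof -
    have "norm (w N n) = norm q ^ (n * (n + a)) * (norm (qpoch q q N) * norm (1 / qpoch q q n) *
        norm (1 / qpoch q q (N - n)))"
      by (simp add: w_def qbinom_def norm_mult norm_divide norm_power)
    also have "\<dots> \<le> 1 * B"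
      unfolding B_def using C q norm_qpoch_le[OF q, of q]
      by (intro mult_mono power_le_one) auto
    finally show ?thesis by simp
  qed
  define F where "F = (\<lambda>s. D (s p) * (\<Prod>i\<in>{1..<p}. w (s (i + 1)) (s i)))"
  have K: "K \<ge> 0" using order_trans[OF norm_ge_zero D[of 0]] by simp
  have fiber: "(\<Sum>s\<in>chain_fiber p N. norm (F s)) \<le> K * B ^ p * (norm q ^ N * real (N + 1) ^ p)" for N
  proof -
    have "(\<Sum>s\<in>chain_fiber p N. norm (F s)) = norm (D N) * chain_sum (\<lambda>N n. norm (w N n)) p N"
      unfolding chain_sum_def sum_distrib_left F_def norm_mult prod_norm
      by (intro sum.cong) (auto simp: chain_fiber_def)
    also have "\<dots> \<le> (K * norm q ^ N) * (B ^ p * real (N + 1) ^ p)"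
      using D K B wB p by (intro mult_mono chain_sum_le) (auto simp: chain_sum_def intro!: sum_nonneg prod_nonneg)
    finally show ?thesis by (simp add: mult_ac)
  qed
  have bij: "bij_betw snd (SIGMA N:UNIV. chain_fiber p N) (chains p)"
    by (rule bij_betwI[of _ _ _ "\<lambda>s. (s p, s)"]) (auto simp: chain_fiber_def)
  have "(\<lambda>Ns. norm (F (snd Ns))) summable_on (SIGMA N:UNIV. chain_fiber p N)"
  proof (rule summable_on_SigmaI)
    show "((\<lambda>s. norm (F (snd (N, s)))) has_sum (\<Sum>s\<in>chain_fiber p N. norm (F s))) (chain_fiber p N)" for N
      using finite_chain_fiber[OF p] by simp
    have "(\<lambda>N. K * B ^ p * (norm q ^ N * real (N + 1) ^ p)) summable_on UNIV"
      using q by (intro summable_on_cmult_right)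
        (subst summable_on_UNIV_nonneg_real_iff, simp, rule summable_poly_geometric, auto)
    then show "(\<lambda>N. \<Sum>s\<in>chain_fiber p N. norm (F s)) summable_on UNIV"
      by (rule summable_on_comparison_test) (use fiber in \<open>auto intro: sum_nonneg\<close>)
  qed simp
  then have "(\<lambda>Ns. F (snd Ns)) summable_on (SIGMA N:UNIV. chain_fiber p N)"
    by (rule abs_summable_summable)
  then have sum: "(\<lambda>(N, s). F s) summable_on (SIGMA N:UNIV. chain_fiber p N)"
    by (simp add: case_prod_unfold)
  have "infsum F (chains p) = (\<Sum>\<^sub>\<infinity>(N, s)\<in>(SIGMA N:UNIV. chain_fiber p N). F s)"
    using infsum_reindex_bij_betw[OF bij, of F] by (simp add: case_prod_unfold)
  also have "\<dots> = (\<Sum>\<^sub>\<infinity>N. \<Sum>s\<in>chain_fiber p N. F s)"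
    using infsum_Sigma'_banach[OF sum] finite_chain_fiber[OF p] by simp
  also have "\<dots> = (\<Sum>\<^sub>\<infinity>N. D N * chain_sum w p N)"
    unfolding chain_sum_def sum_distrib_left F_def
    by (intro infsum_cong sum.cong) (auto simp: chain_fiber_def)
  finally show ?thesis by (simp only: F_def)
qed

lemma norm_bailey_alpha_le: "norm (bailey_alpha a q r) \<le> 2"
proof -
  have le: "norm (q ^ n) \<le> 1" for n using q by (simp add: norm_power power_le_one)
  have "norm (if a = 0 then 1 + q ^ r else 1 - q ^ (2 * r + 1)) \<le> 2"
    using norm_triangle_ineq[of 1 "q ^ r"] norm_triangle_ineq4[of 1 "q ^ (2 * r + 1)"]
      le[of r] le[of "2 * r + 1"] by auto
  then have "norm (q ^ (r choose 2)) * norm (if a = 0 then 1 + q ^ r else 1 - q ^ (2 * r + 1)) \<le> 1 * 2"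
    using le by (intro mult_mono) auto
  then show ?thesis by (simp add: bailey_alpha_def norm_mult norm_power)
qed

text \<open>With N = r + j the decay |q|^N of the top factor is already geometric in r and j
  jointly. All other factors need only be bounded for the sum over r to move outside.\<close>

lemma infsum_chains_bailey:
  assumes p: "p \<ge> 1" and a: "a \<le> 1" and D: "\<And>N. norm (D N) \<le> K * norm q ^ N"
  shows "(\<Sum>\<^sub>\<infinity>s\<in>chains p. D (s p) * (\<Prod>i\<in>{1..<p}. q ^ (s i * (s i + a)) * qbinom q (s (i + 1)) (s i)))
    = (\<Sum>\<^sub>\<infinity>r. q ^ (p * (r * (r + a))) * (bailey_alpha a q r *
        (\<Sum>\<^sub>\<infinity>j. D (r + j) * qpoch q q (r + j) / (qpoch q q j * qpoch q q (2 * r + j + a)))))"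
proof -
  define A where "A = (\<lambda>r. q ^ (p * (r * (r + a))) * bailey_alpha a q r)"
  define f where "f = (\<lambda>r j. A r *
    (D (r + j) * qpoch q q (r + j) / (qpoch q q j * qpoch q q (2 * r + j + a))))"
  obtain C where C: "C \<ge> 1" "\<And>n. norm (1 / qpoch q q n) \<le> C"
    by (rule inverse_qpoch_bounded[OF q]) auto
  let ?E = "exp (1 / (1 - norm q))"
  have K: "K \<ge> 0" using order_trans[OF norm_ge_zero D[of 0]] by simp
  have bound: "norm (f r j) \<le> (2 * K * ?E * (C * C)) * norm q ^ (r + j)" for r j
  proof -
    have "norm (A r) \<le> 1 * 2"
      unfolding A_def norm_mult norm_power using q norm_bailey_alpha_le
      by (intro mult_mono power_le_one) auto
    moreover have "norm (f r j) = norm (A r) * ((norm (D (r + j)) * norm (qpoch q q (r + j))) *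
        (norm (1 / qpoch q q j) * norm (1 / qpoch q q (2 * r + j + a))))"
      by (simp add: f_def norm_mult norm_divide)
    moreover have "\<dots> \<le> 2 * (((K * norm q ^ (r + j)) * ?E) * (C * C))"
      using C q D K norm_qpoch_le[OF q, of q] calculation(1)
      by (intro mult_mono) auto
    ultimately show ?thesis by (simp add: mult_ac)
  qed
  have "(\<Sum>\<^sub>\<infinity>s\<in>chains p. D (s p) * (\<Prod>i\<in>{1..<p}. q ^ (s i * (s i + a)) * qbinom q (s (i + 1)) (s i)))
    = (\<Sum>\<^sub>\<infinity>N. D N * chain_sum (\<lambda>N n. q ^ (n * (n + a)) * qbinom q N n) p N)"
    by (rule infsum_chains[OF p D])
  also have "\<dots> = (\<Sum>\<^sub>\<infinity>N. \<Sum>r\<le>N. f r (N - r))"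
    unfolding chain_sum_bailey[OF q a p] sum_distrib_left
    by (intro infsum_cong sum.cong) (auto simp: f_def A_def ac_simps mult_2_right)
  also have "\<dots> = (\<Sum>\<^sub>\<infinity>r. \<Sum>\<^sub>\<infinity>j. f r j)"
    using triangle_sum(2)[OF norm_ge_zero q bound] by (rule infsumI)
  finally show ?thesis unfolding f_def A_def infsum_cmult_right' by (simp only: mult.assoc)
qed

end

section \<open>Evaluation of the sum over N at fixed r\<close>

text \<open>Terms of a partial theta series in y; without the last factor the exponent of q is (3
  i^2 + i) / 2 + d i, the origin of the entry 3 of A.\<close>

definition theta_term :: "complex \<Rightarrow> nat \<Rightarrow> complex \<Rightarrow> nat \<Rightarrow> complex" where
  "theta_term q d y i = (- y) ^ i * q ^ ((i choose 2) + i\<^sup>2 + Suc d * i) * qpoch q (q ^ Suc i) d"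

text \<open>The contribution of a fixed r apart from q^(p r (r+a)); nothing in it depends on
  p.\<close>

definition bailey_inner :: "complex \<Rightarrow> nat \<Rightarrow> (nat \<Rightarrow> complex) \<Rightarrow> nat \<Rightarrow> complex" where
  "bailey_inner q a D r = bailey_alpha a q r *
     (\<Sum>\<^sub>\<infinity>j. D (r + j) * qpoch q q (r + j) / (qpoch q q j * qpoch q q (2 * r + j + a)))"

context
  fixes q :: complex
  assumes q: "norm q < 1"
begin

lemma norm_power_q_le: "norm (q ^ n) \<le> 1"
  using q by (simp add: norm_power power_le_one)

lemma theta_term_summable: "norm y \<le> 1 \<Longrightarrow> theta_term q d y summable_on UNIV"
  using qpoch_geometric_sum(1)[OF q] unfolding theta_term_def by blast

lemma qpoch_geometric_has_sum:
  assumes "norm y \<le> 1"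
  shows "((\<lambda>j. q ^ (Suc d * j) * qpoch q (y * q ^ j) j / qpoch q q j) has_sum
           (infsum (theta_term q d y) UNIV / qpoch_inf q)) UNIV"
  using qpoch_geometric_sum(2)[OF q assms] unfolding theta_term_def by simp

text \<open>After j is replaced by j + 1 this is the geometric sum at y q^2. The value 0 at j = 0
  reflects the factor 1 - q^j that produces such terms and keeps the truncated j - 1 out of
  play.\<close>

lemma qpoch_geometric_shifted_has_sum:
  assumes y: "norm y \<le> 1"
  shows "((\<lambda>j. if j = 0 then 0 else q ^ (Suc d * j) * qpoch q (y * q ^ Suc j) (j - 1) / qpoch q q (j - 1))
      has_sum (q ^ Suc d * infsum (theta_term q d (y * q\<^sup>2)) UNIV / qpoch_inf q)) UNIV"
    (is "(?h has_sum _) UNIV")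
proof -
  have "norm (y * q\<^sup>2) \<le> 1"
    using y norm_power_q_le[of 2] by (simp add: norm_mult mult_le_one)
  from has_sum_cmult_right[OF qpoch_geometric_has_sum[OF this], of "q ^ Suc d" d]
  have "((\<lambda>j. ?h (Suc j)) has_sum (q ^ Suc d * infsum (theta_term q d (y * q\<^sup>2)) UNIV / qpoch_inf q)) UNIV"
    by (simp add: power_add power2_eq_square mult_ac)
  then show ?thesis using has_sum_Suc_iff[of ?h] by simp
qed

lemma qpoch_ratio: "qpoch q q (m + n) / qpoch q q m = qpoch q (q ^ Suc m) n"
  using qpoch_q_nonzero[OF q] by (simp add: qpoch_add)

lemma qpoch_double: "qpoch q (q ^ Suc N) N * qpoch q q N = qpoch q q (2 * N)"
  using qpoch_add[of q q N N] by (metis mult.commute mult_2 power_Suc)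

text \<open>(q^(N+1))_{N+1} (q)_N = (q)_{2N+1} and 2N + 1 = (2r + j + 1) + j, so division by
  (q)_{2r+j+1} leaves exactly (y q^j)_j with y = q^(2r+2).\<close>

lemma bailey_inner_1:
  "qpoch_inf q * bailey_inner q 1 (\<lambda>N. q ^ N * qpoch q (q ^ (N + 1)) (N + 1)) r
    = bailey_alpha 1 q r * q ^ r * infsum (theta_term q 0 (q ^ (2 * r + 2))) UNIV"
proof -
  have "q ^ (r + j) * qpoch q (q ^ (r + j + 1)) (r + j + 1) * qpoch q q (r + j)
        / (qpoch q q j * qpoch q q (2 * r + j + 1))
      = q ^ r * (q ^ (Suc 0 * j) * qpoch q (q ^ (2 * r + 2) * q ^ j) j / qpoch q q j)" for j
  proof -
    have "qpoch q (q ^ (r + j + 1)) (r + j + 1) * qpoch q q (r + j) = qpoch q q ((2 * r + j + 1) + j)"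
    proof -
      have "(2 * r + j + 1) + j = (r + j) + (r + j + 1)" by simp
      then show ?thesis by (simp only: qpoch_add) (simp add: mult.commute)
    qed
    then have "q ^ (r + j) * qpoch q (q ^ (r + j + 1)) (r + j + 1) * qpoch q q (r + j)
        / (qpoch q q j * qpoch q q (2 * r + j + 1))
      = q ^ (r + j) * (qpoch q q ((2 * r + j + 1) + j) / qpoch q q (2 * r + j + 1)) / qpoch q q j"
      by (simp add: mult_ac)
    then show ?thesis unfolding qpoch_ratio by (simp add: power_add mult_ac)
  qed
  then have "bailey_inner q 1 (\<lambda>N. q ^ N * qpoch q (q ^ (N + 1)) (N + 1)) r = bailey_alpha 1 q r *
      (q ^ r * (infsum (theta_term q 0 (q ^ (2 * r + 2))) UNIV / qpoch_inf q))"
    unfolding bailey_inner_def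
    by (simp only: infsum_cmult_right' infsumI[OF qpoch_geometric_has_sum[OF norm_power_q_le]])
  then show ?thesis using qpoch_inf_nonzero[OF q] by simp
qed

text \<open>The other direct case: 2N = (2r + j) + j, which leaves (y q^j)_j with y =
  q^(2r+1).\<close>

lemma bailey_inner_5:
  "qpoch_inf q * bailey_inner q 0 (\<lambda>N. q ^ N * qpoch q (q ^ (N + 1)) N) r
    = bailey_alpha 0 q r * q ^ r * infsum (theta_term q 0 (q ^ (2 * r + 1))) UNIV"
proof -
  have "q ^ (r + j) * qpoch q (q ^ (r + j + 1)) (r + j) * qpoch q q (r + j)
        / (qpoch q q j * qpoch q q (2 * r + j + 0))
      = q ^ r * (q ^ (Suc 0 * j) * qpoch q (q ^ (2 * r + 1) * q ^ j) j / qpoch q q j)" for j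
  proof -
    have "qpoch q (q ^ (r + j + 1)) (r + j) * qpoch q q (r + j) = qpoch q q ((2 * r + j) + j)"
      using qpoch_double[of "r + j"] by (simp add: algebra_simps)
    then have "q ^ (r + j) * qpoch q (q ^ (r + j + 1)) (r + j) * qpoch q q (r + j)
        / (qpoch q q j * qpoch q q (2 * r + j + 0))
      = q ^ (r + j) * (qpoch q q ((2 * r + j) + j) / qpoch q q (2 * r + j)) / qpoch q q j"
      by (simp add: mult_ac)
    then show ?thesis unfolding qpoch_ratio by (simp add: power_add mult_ac)
  qed
  then have "bailey_inner q 0 (\<lambda>N. q ^ N * qpoch q (q ^ (N + 1)) N) r = bailey_alpha 0 q r *
      (q ^ r * (infsum (theta_term q 0 (q ^ (2 * r + 1))) UNIV / qpoch_inf q))"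
    unfolding bailey_inner_def
    by (simp only: infsum_cmult_right' infsumI[OF qpoch_geometric_has_sum[OF norm_power_q_le]])
  then show ?thesis using qpoch_inf_nonzero[OF q] by simp
qed

lemma qpoch_geometric_combined_infsum:
  assumes y: "norm y \<le> 1"
  shows "(\<Sum>\<^sub>\<infinity>j. q ^ (Suc d * j) * qpoch q (y * q ^ j) j / qpoch q q j + z *
      (if j = 0 then 0 else q ^ (Suc d * j) * qpoch q (y * q ^ Suc j) (j - 1) / qpoch q q (j - 1)))
    = (infsum (theta_term q d y) UNIV + z * q ^ Suc d * infsum (theta_term q d (y * q\<^sup>2)) UNIV)
      / qpoch_inf q"
  using infsumI[OF has_sum_add[OF qpoch_geometric_has_sum[OF y]
    has_sum_cmult_right[OF qpoch_geometric_shifted_has_sum[OF y], of z]]]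
  by (simp add: add_divide_distrib mult.assoc)

text \<open>For \<open>k = 3, 4\<close> the factor \<open>1 - y\<close> of \<open>\<alpha>\<^sub>r\<close>, where \<open>y = q\<^bsup>2r+1\<^esup>\<close>, is split as
  \<open>(1 - yq\<^sup>j) - y(1 - q\<^sup>j)\<close>: the first part completes \<open>(yq\<^bsup>j+1\<^esup>)\<^bsub>j-1\<^esub>\<close> to \<open>(yq\<^sup>j)\<^sub>j\<close>, the second
  lowers \<open>(q)\<^sub>j\<close> to \<open>(q)\<^bsub>j-1\<^esub>\<close>.\<close>

lemma bailey_inner_34:
  "qpoch_inf q * bailey_inner q 1 (\<lambda>N. q ^ (Suc d * N) * qpoch q (q ^ (N + 1)) N) r
    = (-1) ^ r * q ^ (r choose 2) * q ^ (Suc d * r) * (infsum (theta_term q d (q ^ (2 * r + 1))) UNIV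
      - q ^ (2 * r + 1) * q ^ Suc d * infsum (theta_term q d (q ^ (2 * r + 3))) UNIV)"
proof -
  define y where "y = q ^ (2 * r + 1)"
  have y1: "norm y \<le> 1" unfolding y_def by (rule norm_power_q_le)
  define h where "h = (\<lambda>j. if j = 0 then 0
    else q ^ (Suc d * j) * qpoch q (y * q ^ Suc j) (j - 1) / qpoch q q (j - 1))"
  have nz: "1 - q ^ Suc n \<noteq> 0" for n using power_neq_1[OF q, of n] by simp
  have "bailey_alpha 1 q r * (q ^ (Suc d * (r + j)) * qpoch q (q ^ (r + j + 1)) (r + j) * qpoch q q (r + j)
        / (qpoch q q j * qpoch q q (2 * r + j + 1)))
      = (-1) ^ r * q ^ (r choose 2) * q ^ (Suc d * r) *
        (q ^ (Suc d * j) * qpoch q (y * q ^ j) j / qpoch q q j + (- y) * h j)" for j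
  proof (cases j)
    \<comment> \<open>Here (q)_{2r} / (q)_{2r+1} = 1 / (1 - y) cancels the factor of alpha_r, so no
      splitting takes place.\<close>
    case 0
    then show ?thesis using nz[of "2 * r"] qpoch_q_nonzero[OF q]
      qpoch_double[of r] by (simp add: bailey_alpha_def h_def qpoch_Suc)
  next
    case (Suc i)
    define W where "W = qpoch q (y * q ^ (i + 2)) i"
    have "qpoch q (q ^ (r + j + 1)) (r + j) * qpoch q q (r + j) = qpoch q q (2 * r + 2 * j)"
      using qpoch_double[of "r + j"] by (simp add: algebra_simps)
    also have "2 * r + 2 * j = (2 * r + j + 1) + i" by (simp add: Suc)
    also have "qpoch q q \<dots> = qpoch q q (2 * r + j + 1) * W"
    proof -
      have "q * q ^ (2 * r + j + 1) = y * q ^ (i + 2)" by (simp add: y_def Suc power_add)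
      then show ?thesis by (simp only: qpoch_add[of q q "2 * r + j + 1"] W_def)
    qed
    finally have 1: "qpoch q (q ^ (r + j + 1)) (r + j) * qpoch q q (r + j) = qpoch q q (2 * r + j + 1) * W" .
    have 2: "qpoch q (y * q ^ j) j = (1 - y * q ^ j) * W"
      unfolding Suc qpoch_Suc_left by (simp add: W_def mult_ac)
    have 3: "h j = q ^ (Suc d * j) * W * (1 - q ^ j) / qpoch q q j"
      using nz[of i] by (simp add: h_def Suc qpoch_Suc W_def mult_ac)
    have "bailey_alpha 1 q r * (q ^ (Suc d * (r + j)) * qpoch q (q ^ (r + j + 1)) (r + j) * qpoch q q (r + j)
        / (qpoch q q j * qpoch q q (2 * r + j + 1)))
      = (-1) ^ r * q ^ (r choose 2) * (1 - y) * (q ^ (Suc d * (r + j)) *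
        (qpoch q q (2 * r + j + 1) * W) / (qpoch q q j * qpoch q q (2 * r + j + 1)))"
      unfolding 1[symmetric] by (simp add: bailey_alpha_def y_def mult_ac)
    also have "\<dots> = (-1) ^ r * q ^ (r choose 2) * q ^ (Suc d * r) *
        (q ^ (Suc d * j) * W * (1 - y) / qpoch q q j)"
      using qpoch_q_nonzero[OF q] by (simp add: distrib_left power_add)
    also have "1 - y = (1 - y * q ^ j) + (- y) * (1 - q ^ j)" by (simp add: algebra_simps)
    also have "q ^ (Suc d * j) * W * \<dots> / qpoch q q j
      = q ^ (Suc d * j) * ((1 - y * q ^ j) * W) / qpoch q q j + (- y) * (q ^ (Suc d * j) * W * (1 - q ^ j) / qpoch q q j)"
      by (simp only: add_divide_distrib distrib_left) (simp add: mult_ac)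
    finally show ?thesis unfolding 2 3 .
  qed
  then have "bailey_inner q 1 (\<lambda>N. q ^ (Suc d * N) * qpoch q (q ^ (N + 1)) N) r =
      (\<Sum>\<^sub>\<infinity>j. (-1) ^ r * q ^ (r choose 2) * q ^ (Suc d * r) *
        (q ^ (Suc d * j) * qpoch q (y * q ^ j) j / qpoch q q j + (- y) * h j))"
    unfolding bailey_inner_def infsum_cmult_right'[symmetric] by (simp only:)
  also have "\<dots> = (-1) ^ r * q ^ (r choose 2) * q ^ (Suc d * r) * ((infsum (theta_term q d y) UNIV
      + (- y) * q ^ Suc d * infsum (theta_term q d (y * q\<^sup>2)) UNIV) / qpoch_inf q)"
    unfolding infsum_cmult_right' h_def qpoch_geometric_combined_infsum[OF y1] ..
  also have "y * q\<^sup>2 = q ^ (2 * r + 3)" by (simp add: y_def power_add power2_eq_square power3_eq_cube)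
  finally show ?thesis using qpoch_inf_nonzero[OF q] by (simp add: y_def)
qed

text \<open>The same splitting for \<open>k = 2\<close>, now with \<open>y = q\<^bsup>2r\<^esup>\<close>:
  \<open>(1 + q\<^sup>r)(1 - q\<^bsup>r+j\<^esup>) = (1 - yq\<^sup>j) + q\<^sup>r(1 - q\<^sup>j)\<close>.\<close>

lemma bailey_inner_2:
  "qpoch_inf q * bailey_inner q 0 (\<lambda>N. q ^ N * qpoch q (q ^ N) N) r
    = (-1) ^ r * q ^ (r choose 2) * q ^ r * (infsum (theta_term q 0 (q ^ (2 * r))) UNIV
      + (if r = 0 then 0 else q ^ (r + 1) * infsum (theta_term q 0 (q ^ (2 * r + 2))) UNIV))"
proof (cases "r = 0")
  \<comment> \<open>With alpha_0 = 1 instead of 1 + q^0 = 2 there is nothing to split, and a single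
    series at y = 1 remains.\<close>
  case True
  have *: "q ^ (0 + j) * qpoch q (q ^ (0 + j)) (0 + j) * qpoch q q (0 + j) / (qpoch q q j * qpoch q q (2 * 0 + j + 0))
    = q ^ (Suc 0 * j) * qpoch q (1 * q ^ j) j / qpoch q q j" for j
    using qpoch_q_nonzero[OF q] by simp
  have "norm (1::complex) \<le> 1" by simp
  from infsumI[OF qpoch_geometric_has_sum[OF this, of 0]]
  have "bailey_inner q 0 (\<lambda>N. q ^ N * qpoch q (q ^ N) N) 0 = infsum (theta_term q 0 1) UNIV / qpoch_inf q"
    unfolding bailey_inner_def * by (simp add: bailey_alpha_def)
  then show ?thesis using True qpoch_inf_nonzero[OF q] by (simp add: numeral_2_eq_2)
next
  case False
  define y where "y = q ^ (2 * r)"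
  have y1: "norm y \<le> 1" unfolding y_def by (rule norm_power_q_le)
  define h where "h = (\<lambda>j. if j = 0 then 0
    else q ^ (Suc 0 * j) * qpoch q (y * q ^ Suc j) (j - 1) / qpoch q q (j - 1))"
  have nz: "1 - q ^ Suc n \<noteq> 0" for n using power_neq_1[OF q, of n] by simp
  have half: "(1 - q ^ N) * qpoch q (q ^ Suc N) (N - 1) * qpoch q q N
    = (1 - q ^ N) * qpoch q q (N + (N - 1))" for N
    by (simp only: qpoch_add) (simp add: mult_ac)
  have "bailey_alpha 0 q r * (q ^ (r + j) * qpoch q (q ^ (r + j)) (r + j) * qpoch q q (r + j)
        / (qpoch q q j * qpoch q q (2 * r + j + 0)))
      = (-1) ^ r * q ^ (r choose 2) * q ^ r *
        (q ^ (Suc 0 * j) * qpoch q (y * q ^ j) j / qpoch q q j + q ^ r * h j)" for j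
  proof -
    obtain k where k: "r + j = Suc k" using False by (cases "r + j") auto
    have "qpoch q (q ^ (r + j)) (r + j) = (1 - q ^ (r + j)) * qpoch q (q ^ Suc (r + j)) ((r + j) - 1)"
      unfolding k by (simp only: qpoch_Suc_left diff_Suc_1) (simp add: mult_ac)
    then have 0: "qpoch q (q ^ (r + j)) (r + j) * qpoch q q (r + j)
      = (1 - q ^ (r + j)) * qpoch q q ((r + j) + (r + j - 1))"
      using half[of "r + j"] by simp
    show ?thesis
    proof (cases j)
      \<comment> \<open>Since 1 - q^(2r) = (1 - q^r)(1 + q^r), the factor 1 + q^r of alpha_r
        completes (1 - q^r) (q)_{2r-1} to (q)_{2r}.\<close>
      case 0
      have r: "r = Suc k" using k 0 by simp
      have "qpoch q q (2 * r) = qpoch q q (r + (r - 1)) * (1 - q ^ (2 * r))"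
        unfolding r by (simp add: qpoch_Suc mult_2)
      also have "1 - q ^ (2 * r) = (1 - q ^ r) * (1 + q ^ r)"
        unfolding mult_2 power_add by (simp add: algebra_simps)
      finally have e: "qpoch q q (2 * r) = qpoch q q (r + (r - 1)) * ((1 - q ^ r) * (1 + q ^ r))" .
      have e2: "qpoch q (q ^ r) r * qpoch q q r = (1 - q ^ r) * qpoch q q (r + (r - 1))"
        using \<open>qpoch q (q ^ (r + j)) (r + j) * _ = _\<close> 0 by simp
      have "(1 + q ^ r) * (qpoch q (q ^ r) r * qpoch q q r) = qpoch q q (2 * r)"
        unfolding e e2 by (simp add: mult_ac)
      then have f: "(1 + q ^ r) * (qpoch q (q ^ r) r * qpoch q q r) / qpoch q q (2 * r) = 1"
        using qpoch_q_nonzero[OF q, of "2 * r"] by simp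
      have "bailey_alpha 0 q r * (q ^ (r + j) * qpoch q (q ^ (r + j)) (r + j) * qpoch q q (r + j)
          / (qpoch q q j * qpoch q q (2 * r + j + 0)))
        = (-1) ^ r * q ^ (r choose 2) * q ^ r *
          ((1 + q ^ r) * (qpoch q (q ^ r) r * qpoch q q r) / qpoch q q (2 * r))"
        using 0 False by (simp add: bailey_alpha_def mult_ac)
      then show ?thesis unfolding f using 0 by (simp add: h_def)
    next
      case (Suc i)
      define W where "W = qpoch q (y * q ^ Suc j) i"
      have "(r + j) + (r + j - 1) = (2 * r + j + 0) + i" by (simp add: Suc)
      moreover have "q * q ^ (2 * r + j + 0) = y * q ^ Suc j" by (simp add: y_def power_add)
      ultimately have 1: "qpoch q (q ^ (r + j)) (r + j) * qpoch q q (r + j)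
          = (1 - q ^ (r + j)) * (qpoch q q (2 * r + j + 0) * W)"
        unfolding 0 by (simp only: qpoch_add[of q q "2 * r + j + 0"] W_def)
      have 2: "qpoch q (y * q ^ j) j = (1 - y * q ^ j) * W"
        unfolding Suc qpoch_Suc_left by (simp add: W_def Suc mult_ac)
      have 3: "h j = q ^ j * W * (1 - q ^ j) / qpoch q q j"
        using nz[of i] by (simp add: h_def Suc qpoch_Suc W_def mult_ac)
      have "bailey_alpha 0 q r * (q ^ (r + j) * qpoch q (q ^ (r + j)) (r + j) * qpoch q q (r + j)
          / (qpoch q q j * qpoch q q (2 * r + j + 0)))
        = (-1) ^ r * q ^ (r choose 2) * (1 + q ^ r) * (q ^ (r + j) *
          ((1 - q ^ (r + j)) * (qpoch q q (2 * r + j + 0) * W)) / (qpoch q q j * qpoch q q (2 * r + j + 0)))"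
        unfolding 1[symmetric] using False by (simp add: bailey_alpha_def mult_ac)
      also have "\<dots> = (-1) ^ r * q ^ (r choose 2) * q ^ r *
          (q ^ j * W * ((1 + q ^ r) * (1 - q ^ (r + j))) / qpoch q q j)"
        using qpoch_q_nonzero[OF q] by (simp add: power_add)
      also have "(1 + q ^ r) * (1 - q ^ (r + j)) = (1 - y * q ^ j) + q ^ r * (1 - q ^ j)"
        unfolding y_def mult_2 power_add by (simp add: algebra_simps)
      also have "q ^ j * W * \<dots> / qpoch q q j
        = q ^ j * ((1 - y * q ^ j) * W) / qpoch q q j + q ^ r * (q ^ j * W * (1 - q ^ j) / qpoch q q j)"
        by (simp only: add_divide_distrib distrib_left) (simp add: mult_ac)
      finally show ?thesis unfolding 2 3 by simp
    qed
  qed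
  then have "bailey_inner q 0 (\<lambda>N. q ^ N * qpoch q (q ^ N) N) r =
      (\<Sum>\<^sub>\<infinity>j. (-1) ^ r * q ^ (r choose 2) * q ^ r *
        (q ^ (Suc 0 * j) * qpoch q (y * q ^ j) j / qpoch q q j + q ^ r * h j))"
    unfolding bailey_inner_def infsum_cmult_right'[symmetric] by (simp only:)
  also have "\<dots> = (-1) ^ r * q ^ (r choose 2) * q ^ r * ((infsum (theta_term q 0 y) UNIV
      + q ^ r * q ^ Suc 0 * infsum (theta_term q 0 (y * q\<^sup>2)) UNIV) / qpoch_inf q)"
    unfolding infsum_cmult_right' h_def qpoch_geometric_combined_infsum[OF y1] ..
  also have "y * q\<^sup>2 = q ^ (2 * r + 2)" by (simp add: y_def power_add power2_eq_square)
  finally show ?thesis using qpoch_inf_nonzero[OF q] False by (simp add: y_def mult_ac)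
qed

end

section \<open>Rows of the Hecke-type double sums\<close>

lemma qpow_add: "qpow \<tau> (a + b) = qpow \<tau> a * qpow \<tau> b"
  by (simp add: qpow_def flip: exp_add) (simp add: algebra_simps)

lemma qpow_power: "qpow \<tau> 1 ^ n = qpow \<tau> (real n)"
  by (simp add: qpow_def flip: exp_of_nat_mult) (simp add: algebra_simps)

text \<open>Powers are collected with natural exponents, then translated in one step by comparing a
  real quadratic polynomial.\<close>

lemma qpow_powerI: "real N = e \<Longrightarrow> qpow \<tau> 1 ^ N = qpow \<tau> e"
  by (simp add: qpow_power)

lemma norm_qpow: "norm (qpow \<tau> r) = exp (- 2 * pi * Im \<tau> * r)"
  by (simp add: qpow_def)

lemma norm_qpow_1_less: "Im \<tau> > 0 \<Longrightarrow> norm (qpow \<tau> 1) < 1"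
  by (simp add: norm_qpow)

text \<open>The term T(m,n). Its sign is given by parity because m + n may be negative.\<close>

definition hecke_term :: "complex \<Rightarrow> nat \<Rightarrow> real \<Rightarrow> real \<Rightarrow> int \<Rightarrow> int \<Rightarrow> complex" where
  "hecke_term \<tau> p v1 v2 m n = (if even (m + n) then 1 else -1) *
     qpow \<tau> (((2 * real p + 1) * (of_int m)\<^sup>2 + 4 * of_int m * of_int n + 3 * (of_int n)\<^sup>2
       + v1 * of_int m + v2 * of_int n) / 2)"

lemma hecke_term_pos:
  "hecke_term \<tau> p v1 v2 (int r) (int n) = (-1) ^ (r + n) *
     qpow \<tau> (((2 * real p + 1) * (real r)\<^sup>2 + 4 * real r * real n + 3 * (real n)\<^sup>2
       + v1 * real r + v2 * real n) / 2)"
  by (simp add: hecke_term_def minus_one_power_iff)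

text \<open>Coordinates on the negative quadrant: the index pair (r,n) of the Bailey side
  corresponds to the row -r-a and the column -1-n.\<close>

lemma hecke_term_neg:
  "hecke_term \<tau> p v1 v2 (- int r - int a) (- 1 - int n) = (-1) ^ (r + n + a + 1) *
     qpow \<tau> (((2 * real p + 1) * (real r + real a)\<^sup>2 + 4 * (real r + real a) * (real n + 1)
       + 3 * (real n + 1)\<^sup>2 - v1 * (real r + real a) - v2 * (real n + 1)) / 2)"
proof -
  have "- int r - int a + (- 1 - int n) = - int (r + n + a + 1)" by simp
  then have 1: "even (- int r - int a + (- 1 - int n)) \<longleftrightarrow> even (r + n + a + 1)"
    by (simp only: dvd_minus_iff even_of_nat_iff)
  have 2: "(2 * real p + 1) * (of_int (- int r - int a))\<^sup>2
       + 4 * of_int (- int r - int a) * of_int (- 1 - int n) + 3 * (of_int (- 1 - int n))\<^sup>2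
       + v1 * of_int (- int r - int a) + v2 * of_int (- 1 - int n)
     = (2 * real p + 1) * (real r + real a)\<^sup>2 + 4 * (real r + real a) * (real n + 1)
       + 3 * (real n + 1)\<^sup>2 - v1 * (real r + real a) - v2 * (real n + 1)"
    by (simp add: algebra_simps power2_eq_square)
  show ?thesis unfolding hecke_term_def minus_one_power_iff 1 2 ..
qed

lemma real_choose_two: "real (n choose 2) = real n * (real n - 1) / 2"
  by (induction n) (simp_all add: numeral_2_eq_2 binomial_eq_0 field_simps)

lemma minus_power_mult: "(- (q ^ k)) ^ n = (-1) ^ n * (q :: complex) ^ (k * n)"
  by (metis mult_minus1 power_mult power_mult_distrib)

context
  fixes \<tau> q :: complex
  assumes \<tau>: "Im \<tau> > 0"
  defines "q \<equiv> qpow \<tau> 1"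
begin

lemma norm_q: "norm q < 1"
  unfolding q_def using \<tau> by (rule norm_qpow_1_less)

lemmas exponent_simps = real_choose_two field_simps power2_eq_square

text \<open>The two summands of 1 + q^r in alpha_r yield the rows r and -r term by term. For r = 0
  these rows coincide, which matches alpha_0 = 1.\<close>

lemma hecke_slice_5:
  "((\<lambda>n. hecke_term \<tau> p 1 3 (int r) (int n)
       - (if r = 0 then 0 else hecke_term \<tau> p 1 3 (- int r - int 0) (- 1 - int n)))
     has_sum qpoch_inf q * (q ^ (p * (r * (r + 0))) *
       bailey_inner q 0 (\<lambda>N. q ^ N * qpoch q (q ^ (N + 1)) N) r)) UNIV"
proof -
  let ?c = "q ^ (p * (r * (r + 0))) * (bailey_alpha 0 q r * q ^ r)"
  have "hecke_term \<tau> p 1 3 (int r) (int n)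
      - (if r = 0 then 0 else hecke_term \<tau> p 1 3 (- int r - int 0) (- 1 - int n))
    = ?c * theta_term q 0 (q ^ (2 * r + 1)) n" for n
  proof -
    let ?N = "p * (r * r) + (r choose 2) + r + ((2 * r + 1) * n + ((n choose 2) + n\<^sup>2 + n))"
    have 1: "q ^ ?N = qpow \<tau> (((2 * real p + 1) * (real r)\<^sup>2 + 4 * real r * real n + 3 * (real n)\<^sup>2
       + real r + 3 * real n) / 2)"
      unfolding q_def by (rule qpow_powerI) (simp add: exponent_simps)
    have 2: "q ^ (?N + r) = qpow \<tau> (((2 * real p + 1) * (real r)\<^sup>2 + 4 * real r * (real n + 1)
       + 3 * (real n + 1)\<^sup>2 - real r - 3 * (real n + 1)) / 2)"
      unfolding q_def by (rule qpow_powerI) (simp add: exponent_simps)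
    have 3: "?c * theta_term q 0 (q ^ (2 * r + 1)) n = (-1) ^ (r + n) * (q ^ ?N + (if r = 0 then 0 else q ^ (?N + r)))"
      unfolding theta_term_def minus_power_mult
      by (cases "r = 0") (simp_all add: bailey_alpha_def power_add algebra_simps mult_2 mult_2_right binomial_eq_0)
    show ?thesis unfolding 3 hecke_term_pos hecke_term_neg 1 2 by (simp add: distrib_left)
  qed
  moreover have "qpoch_inf q * (q ^ (p * (r * (r + 0))) *
       bailey_inner q 0 (\<lambda>N. q ^ N * qpoch q (q ^ (N + 1)) N) r)
    = ?c * infsum (theta_term q 0 (q ^ (2 * r + 1))) UNIV"
    using bailey_inner_5[OF norm_q, of r] by (simp add: mult_ac)
  ultimately show ?thesis
    by (simp only:) (intro has_sum_cmult_right has_sum_infsum theta_term_summable norm_q norm_power_q_le)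
qed

text \<open>The summands 1 and -q^(2r+1) of alpha_r yield the rows r and -r-1, which are distinct
  for every r.\<close>

lemma hecke_slice_1:
  "((\<lambda>n. hecke_term \<tau> p (2 * real p + 1) 5 (int r) (int n)
       - hecke_term \<tau> p (2 * real p + 1) 5 (- int r - int 1) (- 1 - int n))
     has_sum qpoch_inf q * (q ^ (p * (r * (r + 1))) *
       bailey_inner q 1 (\<lambda>N. q ^ N * qpoch q (q ^ (N + 1)) (N + 1)) r)) UNIV"
proof -
  let ?c = "q ^ (p * (r * (r + 1))) * (bailey_alpha 1 q r * q ^ r)"
  have "hecke_term \<tau> p (2 * real p + 1) 5 (int r) (int n)
      - hecke_term \<tau> p (2 * real p + 1) 5 (- int r - int 1) (- 1 - int n)
    = ?c * theta_term q 0 (q ^ (2 * r + 2)) n" for n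
  proof -
    let ?N = "p * (r * (r + 1)) + (r choose 2) + r + ((2 * r + 2) * n + ((n choose 2) + n\<^sup>2 + n))"
    have 1: "q ^ ?N = qpow \<tau> (((2 * real p + 1) * (real r)\<^sup>2 + 4 * real r * real n + 3 * (real n)\<^sup>2
       + (2 * real p + 1) * real r + 5 * real n) / 2)"
      unfolding q_def by (rule qpow_powerI) (simp add: exponent_simps)
    have 2: "q ^ (?N + (2 * r + 1)) = qpow \<tau> (((2 * real p + 1) * (real r + real 1)\<^sup>2 + 4 * (real r + real 1) * (real n + 1)
       + 3 * (real n + 1)\<^sup>2 - (2 * real p + 1) * (real r + real 1) - 5 * (real n + 1)) / 2)"
      unfolding q_def by (rule qpow_powerI) (simp add: exponent_simps)
    have 3: "?c * theta_term q 0 (q ^ (2 * r + 2)) n = (-1) ^ (r + n) * (q ^ ?N - q ^ (?N + (2 * r + 1)))"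
      unfolding theta_term_def minus_power_mult
      by (simp add: bailey_alpha_def power_add algebra_simps mult_2 mult_2_right)
    show ?thesis unfolding 3 hecke_term_pos hecke_term_neg 1 2 by (simp add: right_diff_distrib)
  qed
  moreover have "qpoch_inf q * (q ^ (p * (r * (r + 1))) *
       bailey_inner q 1 (\<lambda>N. q ^ N * qpoch q (q ^ (N + 1)) (N + 1)) r)
    = ?c * infsum (theta_term q 0 (q ^ (2 * r + 2))) UNIV"
    using bailey_inner_1[OF norm_q, of r] by (simp add: mult_ac)
  ultimately show ?thesis
    by (simp only:) (intro has_sum_cmult_right has_sum_infsum theta_term_summable norm_q norm_power_q_le)
qed

text \<open>Here each of the two partial theta series is one row: the series at q^(2r) is the row r,
  the one at q^(2r+2) the row -r.\<close>

lemma hecke_slice_2: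
  "((\<lambda>n. hecke_term \<tau> p 1 1 (int r) (int n)
       - (if r = 0 then 0 else hecke_term \<tau> p 1 1 (- int r - int 0) (- 1 - int n)))
     has_sum qpoch_inf q * (q ^ (p * (r * (r + 0))) *
       bailey_inner q 0 (\<lambda>N. q ^ N * qpoch q (q ^ N) N) r)) UNIV"
proof -
  let ?c = "q ^ (p * (r * (r + 0))) * ((-1) ^ r * q ^ (r choose 2) * q ^ r)"
  let ?d = "if r = 0 then 0 else q ^ (r + 1)"
  have "hecke_term \<tau> p 1 1 (int r) (int n)
      - (if r = 0 then 0 else hecke_term \<tau> p 1 1 (- int r - int 0) (- 1 - int n))
    = ?c * (theta_term q 0 (q ^ (2 * r)) n + ?d * theta_term q 0 (q ^ (2 * r + 2)) n)" for n
  proof -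
    let ?M = "p * (r * r) + (r choose 2) + r"
    let ?N = "?M + (2 * r * n + ((n choose 2) + n\<^sup>2 + n))"
    let ?N' = "?M + (r + 1 + (2 * r + 2) * n + ((n choose 2) + n\<^sup>2 + n))"
    have 1: "q ^ ?N = qpow \<tau> (((2 * real p + 1) * (real r)\<^sup>2 + 4 * real r * real n + 3 * (real n)\<^sup>2
       + real r + real n) / 2)"
      unfolding q_def by (rule qpow_powerI) (simp add: exponent_simps)
    have 2: "q ^ ?N' = qpow \<tau> (((2 * real p + 1) * (real r)\<^sup>2 + 4 * real r * (real n + 1)
       + 3 * (real n + 1)\<^sup>2 - real r - (real n + 1)) / 2)"
      unfolding q_def by (rule qpow_powerI) (simp add: exponent_simps)
    have 3: "?c * (theta_term q 0 (q ^ (2 * r)) n + ?d * theta_term q 0 (q ^ (2 * r + 2)) n)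
      = (-1) ^ (r + n) * (q ^ ?N + (if r = 0 then 0 else q ^ ?N'))"
      unfolding theta_term_def minus_power_mult
      by (simp add: power_add algebra_simps mult_2 mult_2_right)
    show ?thesis unfolding 3 hecke_term_pos hecke_term_neg 1 2 by (simp add: distrib_left)
  qed
  moreover have "qpoch_inf q * (q ^ (p * (r * (r + 0))) *
       bailey_inner q 0 (\<lambda>N. q ^ N * qpoch q (q ^ N) N) r)
    = ?c * (infsum (theta_term q 0 (q ^ (2 * r))) UNIV + ?d * infsum (theta_term q 0 (q ^ (2 * r + 2))) UNIV)"
    using bailey_inner_2[OF norm_q, of r] by (simp add: mult_ac)
  ultimately show ?thesis
    by (simp only:) (intro has_sum_add has_sum_cmult_right has_sum_infsum theta_term_summable norm_q norm_power_q_le)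
qed

lemma theta_term_has_sum:
  "(theta_term q d (q ^ k) has_sum infsum (theta_term q d (q ^ k)) UNIV) UNIV"
  by (intro has_sum_infsum theta_term_summable norm_q norm_power_q_le)

lemma Suc_choose_two: "Suc m choose 2 = (m choose 2) + m"
  by (simp add: numeral_2_eq_2)

text \<open>Here the two sums do not match termwise: the terms \<open>n = 0\<close> of both partial theta series must be
  interchanged.\<close>

lemma hecke_slice_4:
  "((\<lambda>n. hecke_term \<tau> p (2 * real p + 1) 1 (int r) (int n)
       - hecke_term \<tau> p (2 * real p + 1) 1 (- int r - int 1) (- 1 - int n))
     has_sum qpoch_inf q * (q ^ (p * (r * (r + 1))) *
       bailey_inner q 1 (\<lambda>N. q ^ N * qpoch q (q ^ (N + 1)) N) r)) UNIV"
proof -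
  define c where "c = q ^ (p * (r * (r + 1))) * ((-1) ^ r * q ^ (r choose 2) * q ^ r)"
  define X where "X = theta_term q 0 (q ^ (2 * r + 1))"
  define Z where "Z = theta_term q 0 (q ^ (2 * r + 3))"
  define z where "z = - (q ^ (2 * r + 1) * q)"
  \<comment> \<open>\<open>U\<close> is the row r up to the factor \<open>c\<close>: its term at 0
    is borrowed from \<open>X\<close>, the later ones are the shifted \<open>Z\<close>. The tail of
    \<open>X\<close> is left for the row -r-1.\<close>
  define U where "U = (\<lambda>n. if n = 0 then X 0 else z * Z (n - 1))"
  have X: "(X has_sum infsum X UNIV) UNIV" and Z: "(Z has_sum infsum Z UNIV) UNIV"
    unfolding X_def Z_def by (rule theta_term_has_sum)+
  have "((\<lambda>n. U (Suc n)) has_sum z * infsum Z UNIV) UNIV"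
    unfolding U_def by simp (rule has_sum_cmult_right[OF Z])
  then have U: "(U has_sum (X 0 + z * infsum Z UNIV)) UNIV"
    unfolding has_sum_Suc_iff by (simp add: U_def)
  have X': "((\<lambda>n. X (Suc n)) has_sum (infsum X UNIV - X 0)) UNIV"
    unfolding has_sum_Suc_iff using X by simp
  have X_eq: "c * X n = (-1) ^ (r + n) * qpow \<tau> (((2 * real p + 1) * ((real r)\<^sup>2 + real r)
      + 4 * real r * real n + 3 * (real n)\<^sup>2 + 3 * real n) / 2)" for n
  proof -
    let ?N = "p * (r * (r + 1)) + (r choose 2) + r + ((2 * r + 1) * n + ((n choose 2) + n\<^sup>2 + n))"
    have "c * X n = (-1) ^ (r + n) * q ^ ?N"
      unfolding X_def c_def theta_term_def minus_power_mult by (simp add: power_add algebra_simps mult_2 mult_2_right)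
    also have "q ^ ?N = qpow \<tau> (((2 * real p + 1) * ((real r)\<^sup>2 + real r)
      + 4 * real r * real n + 3 * (real n)\<^sup>2 + 3 * real n) / 2)"
      unfolding q_def by (rule qpow_powerI) (simp add: exponent_simps)
    finally show ?thesis .
  qed
  have pos: "hecke_term \<tau> p (2 * real p + 1) 1 (int r) (int n) = c * U n" for n
  proof (cases n)
    case 0
    then show ?thesis unfolding hecke_term_pos U_def by (simp add: X_eq algebra_simps)
  next
    case (Suc m)
    let ?N = "p * (r * (r + 1)) + (r choose 2) + r + (2 * r + 1 + 1 + (2 * r + 3) * m + ((m choose 2) + m\<^sup>2 + m))"
    have "c * U n = (-1) ^ (r + n) * q ^ ?N"
    proof -
      have e: "q ^ ?N = q ^ (p * (r * (r + 1))) * q ^ (r choose 2) * q ^ r *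
          (q ^ (2 * r + 1) * q * q ^ ((2 * r + 3) * m) * q ^ ((m choose 2) + m\<^sup>2 + m))"
        by (simp only: power_add power_one_right mult_ac)
      show ?thesis
        unfolding e U_def Suc Z_def z_def c_def theta_term_def minus_power_mult
        by (simp add: power_add[of "-1" r])
    qed
    also have "q ^ ?N = qpow \<tau> (((2 * real p + 1) * (real r)\<^sup>2 + 4 * real r * real n
       + 3 * (real n)\<^sup>2 + (2 * real p + 1) * real r + 1 * real n) / 2)"
      unfolding q_def Suc by (rule qpow_powerI) (simp add: exponent_simps)
    finally show ?thesis unfolding hecke_term_pos ..
  qed
  have neg: "hecke_term \<tau> p (2 * real p + 1) 1 (- int r - int 1) (- 1 - int n) = - (c * X (Suc n))" for n
    unfolding hecke_term_neg X_eq by (simp add: algebra_simps power2_eq_square)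
  have "((\<lambda>n. c * (U n + X (Suc n))) has_sum c * ((X 0 + z * infsum Z UNIV) + (infsum X UNIV - X 0))) UNIV"
    by (intro has_sum_cmult_right has_sum_add U X')
  moreover have "qpoch_inf q * (q ^ (p * (r * (r + 1))) *
       bailey_inner q 1 (\<lambda>N. q ^ N * qpoch q (q ^ (N + 1)) N) r)
    = c * ((X 0 + z * infsum Z UNIV) + (infsum X UNIV - X 0))"
    using bailey_inner_34[OF norm_q, of 0 r] by (simp add: c_def X_def Z_def z_def mult_ac)
  ultimately show ?thesis unfolding pos neg by (simp add: distrib_left)
qed

text \<open>For d = 1 every theta term carries a factor 1 - q^(i+1), and neither series is a row by
  itself. Adding the second series, shifted by one index, cancels the middle terms.\<close>

lemma hecke_slice_3:
  "((\<lambda>n. hecke_term \<tau> p (2 * real p + 3) 3 (int r) (int n)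
       - hecke_term \<tau> p (2 * real p + 3) 3 (- int r - int 1) (- 1 - int n))
     has_sum qpoch_inf q * (q ^ (p * (r * (r + 1))) *
       bailey_inner q 1 (\<lambda>N. q ^ (2 * N) * qpoch q (q ^ (N + 1)) N) r)) UNIV"
proof -
  define c where "c = q ^ (p * (r * (r + 1))) * ((-1) ^ r * q ^ (r choose 2) * q ^ (2 * r))"
  define X where "X = theta_term q 1 (q ^ (2 * r + 1))"
  define Z where "Z = theta_term q 1 (q ^ (2 * r + 3))"
  define z where "z = - (q ^ (2 * r + 1) * q\<^sup>2)"
  define U where "U = (\<lambda>n. if n = 0 then 0 else z * Z (n - 1))"
  have X: "(X has_sum infsum X UNIV) UNIV" and Z: "(Z has_sum infsum Z UNIV) UNIV"
    unfolding X_def Z_def by (rule theta_term_has_sum)+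
  have "((\<lambda>n. U (Suc n)) has_sum z * infsum Z UNIV) UNIV"
    unfolding U_def by simp (rule has_sum_cmult_right[OF Z])
  then have U: "(U has_sum z * infsum Z UNIV) UNIV"
    unfolding has_sum_Suc_iff by (simp add: U_def)
  have term_eq: "hecke_term \<tau> p (2 * real p + 3) 3 (int r) (int n)
       - hecke_term \<tau> p (2 * real p + 3) 3 (- int r - int 1) (- 1 - int n) = c * (X n + U n)" for n
  proof -
    let ?M = "p * (r * (r + 1)) + (r choose 2) + 2 * r"
    let ?N = "(2 * r + 1) * n + ((n choose 2) + n\<^sup>2 + n)"
    have 1: "q ^ (?M + ?N) = qpow \<tau> (((2 * real p + 1) * (real r)\<^sup>2 + 4 * real r * real n + 3 * (real n)\<^sup>2
       + (2 * real p + 3) * real r + 3 * real n) / 2)"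
      unfolding q_def by (rule qpow_powerI) (simp add: exponent_simps)
    have 2: "q ^ (?M + ?N + (2 * n + 1)) = qpow \<tau> (((2 * real p + 1) * (real r + real 1)\<^sup>2 + 4 * (real r + real 1) * (real n + 1)
       + 3 * (real n + 1)\<^sup>2 - (2 * real p + 3) * (real r + real 1) - 3 * (real n + 1)) / 2)"
      unfolding q_def by (rule qpow_powerI) (simp add: exponent_simps)
    have X_eq: "X n = (-1) ^ n * q ^ ?N * (q ^ n - q ^ (2 * n + 1))"
      unfolding X_def theta_term_def minus_power_mult
      by (simp add: power_add qpoch_Suc algebra_simps mult_2 mult_2_right)
    have U_eq: "U n = (-1) ^ n * q ^ ?N * (1 - q ^ n)"
    proof (cases n)
      case (Suc m)
      have "2 * r + 1 + 2 + (2 * r + 3) * m + ((m choose 2) + m\<^sup>2 + 2 * m) = ?N"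
        unfolding Suc Suc_choose_two by (simp add: power2_eq_square algebra_simps)
      then have e: "q ^ ?N = q ^ (2 * r + 1) * q\<^sup>2 * q ^ ((2 * r + 3) * m) * q ^ ((m choose 2) + m\<^sup>2 + 2 * m)"
        by (metis power_add)
      have "U n = z * ((-1) ^ m * q ^ ((2 * r + 3) * m) * q ^ ((m choose 2) + m\<^sup>2 + 2 * m) * (1 - q ^ n))"
        unfolding U_def Z_def Suc theta_term_def minus_power_mult Suc_1 by (simp add: qpoch_Suc)
      also have "\<dots> = (-1) ^ n * (q ^ (2 * r + 1) * q\<^sup>2 * q ^ ((2 * r + 3) * m) *
          q ^ ((m choose 2) + m\<^sup>2 + 2 * m)) * (1 - q ^ n)"
        unfolding z_def Suc power_Suc[of "-1"] by (simp only: mult_minus_left mult_minus_right mult_1 mult_ac)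
      finally show ?thesis by (simp only: e)
    qed (simp add: U_def)
    \<comment> \<open>(q^n - q^(2n+1)) + (1 - q^n) = 1 - q^(2n+1): one summand for each of the two
      rows. The value \<open>U 0 = 0\<close> agrees with 1 - q^0.\<close>
    have XU_eq: "X n + U n = (-1) ^ n * q ^ ?N * (1 - q ^ (2 * n + 1))"
      unfolding X_eq U_eq by (simp only: distrib_left[symmetric]) simp
    have "c * (X n + U n) = (-1) ^ (r + n) * (q ^ (?M + ?N) - q ^ (?M + ?N + (2 * n + 1)))"
      unfolding XU_eq c_def power_add[of q ?M] power_add[of q "?M + ?N"] power_add[of "-1" r]
      by (simp add: power_add algebra_simps)
    then show ?thesis unfolding hecke_term_pos hecke_term_neg 1 2 by (simp add: right_diff_distrib)
  qed
  have "((\<lambda>n. c * (X n + U n)) has_sum c * (infsum X UNIV + z * infsum Z UNIV)) UNIV"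
    by (intro has_sum_cmult_right has_sum_add U X)
  moreover have "qpoch_inf q * (q ^ (p * (r * (r + 1))) *
       bailey_inner q 1 (\<lambda>N. q ^ (2 * N) * qpoch q (q ^ (N + 1)) N) r)
    = c * (infsum X UNIV + z * infsum Z UNIV)"
    using bailey_inner_34[OF norm_q, of 1 r, unfolded Suc_1] by (simp add: c_def X_def Z_def z_def mult_ac power2_eq_square)
  ultimately show ?thesis unfolding term_eq by simp
qed

end

section \<open>Absolute convergence of the double sum and reassembly of its rows\<close>

lemma summable_on_int_geometric:
  fixes r :: real
  assumes "0 \<le> r" "r < 1"
  shows "(\<lambda>m::int. r ^ nat \<bar>m\<bar>) summable_on UNIV"
proof -
  have "(\<lambda>m::int. r ^ nat \<bar>m\<bar>) summable_on range int"
    using geometric_summable_on[OF assms] by (subst summable_on_reindex) (auto simp: o_def)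
  moreover have "(\<lambda>m::int. r ^ nat \<bar>m\<bar>) summable_on range (\<lambda>n. - int n)"
    using geometric_summable_on[OF assms]
    by (subst summable_on_reindex) (auto simp: o_def inj_on_def)
  moreover have "range int \<union> range (\<lambda>n. - int n) = UNIV"
  proof -
    have "m \<in> range int \<union> range (\<lambda>n. - int n)" for m :: int
      by (cases m rule: int_cases2) auto
    then show ?thesis by auto
  qed
  ultimately show ?thesis using summable_on_union by metis
qed

text \<open>For p >= 1 the quadratic form is at least 3m^2 + 4mn + 3n^2 = m^2 + n^2 + 2(m+n)^2, so
  the variables separate, and the squares absorb the linear terms.\<close>

lemma hecke_term_summable:
  assumes "Im \<tau> > 0" "p \<ge> 1"
  shows "(\<lambda>(m, n). hecke_term \<tau> p v1 v2 m n) summable_on UNIV"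
proof -
  define y where "y = pi * Im \<tau>"
  have y: "y > 0" using assms by (simp add: y_def)
  define r where "r = exp (- y)"
  have r: "0 \<le> r" "r < 1" using y by (auto simp: r_def)
  define c where "c v = exp (y * (\<bar>v\<bar> + 1)\<^sup>2)" for v :: real
  \<comment> \<open>The constant comes from x^2 - b|x| + b^2 >= 0 with b = |v| + 1.\<close>
  have le: "\<bar>x\<bar> - (\<bar>v\<bar> + 1)\<^sup>2 \<le> x\<^sup>2 + v * x" for x v :: real
  proof -
    have "- (\<bar>v\<bar> * \<bar>x\<bar>) \<le> v * x" by (metis abs_le_D2 abs_mult minus_le_iff order_refl)
    moreover have "0 \<le> x\<^sup>2 - b * \<bar>x\<bar> + b\<^sup>2" for b
    proof -
      have "(\<bar>x\<bar> - b / 2)\<^sup>2 + 3 / 4 * b\<^sup>2 = x\<^sup>2 - b * \<bar>x\<bar> + b\<^sup>2"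
        by (simp add: power2_diff power_divide)
      then show ?thesis by (metis add_nonneg_nonneg mult_nonneg_nonneg zero_le_power2 zero_le_divide_iff zero_le_numeral)
    qed
    note this[of "\<bar>v\<bar> + 1"]
    moreover have "(\<bar>v\<bar> + 1) * \<bar>x\<bar> = \<bar>v\<bar> * \<bar>x\<bar> + \<bar>x\<bar>" by (simp add: algebra_simps)
    ultimately show ?thesis by linarith
  qed
  have "norm (hecke_term \<tau> p v1 v2 m n) \<le> c v1 * c v2 * (r ^ nat \<bar>m\<bar> * r ^ nat \<bar>n\<bar>)" for m n
  proof -
    let ?m = "real_of_int m" and ?n = "real_of_int n"
    have "3 * ?m\<^sup>2 \<le> (2 * real p + 1) * ?m\<^sup>2" using assms by (intro mult_right_mono) auto
    moreover have "0 \<le> 2 * (?m + ?n)\<^sup>2" by simp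
    ultimately have "?m\<^sup>2 + ?n\<^sup>2 \<le> (2 * real p + 1) * ?m\<^sup>2 + 4 * ?m * ?n + 3 * ?n\<^sup>2"
      unfolding power2_sum by simp
    then have E: "\<bar>?m\<bar> + \<bar>?n\<bar> - (\<bar>v1\<bar> + 1)\<^sup>2 - (\<bar>v2\<bar> + 1)\<^sup>2
      \<le> (2 * real p + 1) * ?m\<^sup>2 + 4 * ?m * ?n + 3 * ?n\<^sup>2 + v1 * ?m + v2 * ?n"
      (is "_ \<le> ?E") using le[of ?m v1] le[of ?n v2] by linarith
    have "norm (hecke_term \<tau> p v1 v2 m n) = exp (- y * ?E)"
      by (simp add: hecke_term_def norm_mult norm_qpow y_def)
    also have "\<dots> \<le> exp (- y * (\<bar>?m\<bar> + \<bar>?n\<bar> - (\<bar>v1\<bar> + 1)\<^sup>2 - (\<bar>v2\<bar> + 1)\<^sup>2))"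
      using y E by simp
    also have "\<dots> = c v1 * c v2 * (exp (- y * \<bar>?m\<bar>) * exp (- y * \<bar>?n\<bar>))"
      by (simp add: c_def flip: exp_add) (simp add: algebra_simps)
    also have "exp (- y * \<bar>?m\<bar>) = r ^ nat \<bar>m\<bar>"
      by (simp add: r_def mult.commute flip: exp_of_nat_mult)
    also have "exp (- y * \<bar>?n\<bar>) = r ^ nat \<bar>n\<bar>"
      by (simp add: r_def mult.commute flip: exp_of_nat_mult)
    finally show ?thesis .
  qed
  then show ?thesis
    using summable_on_cmult_right[OF summable_on_product_real[OF summable_on_int_geometric[OF r]
        summable_on_int_geometric[OF r]], of "c v1 * c v2"] r
    by (intro complex_summable_on_comparison[where g = "\<lambda>mn. c v1 * c v2 * (case mn of (m, n) \<Rightarrow> r ^ nat \<bar>m\<bar> * r ^ nat \<bar>n\<bar>)"]) auto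
qed

lemma infsum_hecke_slices:
  fixes T :: "int \<Rightarrow> int \<Rightarrow> complex" and a :: nat
  assumes T: "(\<lambda>(m, n). T m n) summable_on UNIV" and a: "a \<le> 1"
    and slice: "\<And>r. ((\<lambda>n. T (int r) (int n) - (if a = 0 \<and> r = 0 then 0
        else T (- int r - int a) (- 1 - int n))) has_sum c r) UNIV"
  shows "infsum c UNIV = (\<Sum>\<^sub>\<infinity>(m, n)\<in>{0..} \<times> {0..}. T m n) - (\<Sum>\<^sub>\<infinity>(m, n)\<in>{..<0} \<times> {..<0}. T m n)"
proof -
  define f where "f = (\<lambda>(m, n). T m n)"
  define F where "F = (\<lambda>(r, n). T (int r) (int n))"
  define G where "G = (\<lambda>(r, n). if a = 0 \<and> r = 0 then 0 else T (- int r - int a) (- 1 - int n))"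
  \<comment> \<open>For a = 0 the index r = 0 would give row 0, which is not negative;
    \<open>G\<close> vanishes there and the bijection leaves it out.\<close>
  define S :: "(nat \<times> nat) set" where "S = {(r, n). \<not> (a = 0 \<and> r = 0)}"
  have sub: "f summable_on A" for A
    using summable_on_subset_banach[of f UNIV A] T by (simp add: f_def)
  have bij1: "bij_betw (\<lambda>(r, n). (int r, int n)) UNIV ({0..} \<times> {0..})"
    by (rule bij_betwI[of _ _ _ "\<lambda>(m, n). (nat m, nat n)"]) auto
  have bij2: "bij_betw (\<lambda>(r, n). (- int r - int a, - 1 - int n)) S ({..<0} \<times> {..<0})"
    using a by (intro bij_betwI[of _ _ _ "\<lambda>(m, n). (nat (- m - int a), nat (- 1 - n))"]) (auto simp: S_def)
  have F: "F summable_on UNIV" "infsum F UNIV = infsum f ({0..} \<times> {0..})"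
    using summable_on_reindex_bij_betw[OF bij1, of f] infsum_reindex_bij_betw[OF bij1, of f] sub
    by (simp_all add: F_def f_def case_prod_unfold)
  have GS: "G x = f (case x of (r, n) \<Rightarrow> (- int r - int a, - 1 - int n))" if "x \<in> S" for x
    using that by (auto simp: S_def G_def f_def)
  have "G summable_on UNIV \<longleftrightarrow> G summable_on S"
    by (rule summable_on_cong_neutral) (auto simp: G_def S_def split: if_splits)
  also have "\<dots> \<longleftrightarrow> (\<lambda>x. f (case x of (r, n) \<Rightarrow> (- int r - int a, - 1 - int n))) summable_on S"
    using GS by (rule summable_on_cong)
  finally have G1: "G summable_on UNIV"
    using summable_on_reindex_bij_betw[OF bij2, of f] sub by simp
  have "infsum G UNIV = infsum G S"
    by (rule infsum_cong_neutral) (auto simp: G_def S_def split: if_splits)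
  also have "\<dots> = infsum (\<lambda>x. f (case x of (r, n) \<Rightarrow> (- int r - int a, - 1 - int n))) S"
    using GS by (rule infsum_cong)
  finally have G2: "infsum G UNIV = infsum f ({..<0} \<times> {..<0})"
    using infsum_reindex_bij_betw[OF bij2, of f] by simp
  have H: "((\<lambda>x. F x - G x) has_sum (infsum F UNIV - infsum G UNIV)) (UNIV \<times> UNIV)"
    using has_sum_add[OF has_sum_infsum[OF F(1)] has_sum_uminusI[OF has_sum_infsum[OF G1]]] by simp
  have "(c has_sum (infsum F UNIV - infsum G UNIV)) UNIV"
    by (rule has_sum_SigmaD[OF H]) (use slice in \<open>simp add: F_def G_def\<close>)
  then show ?thesis unfolding F(2) G2 f_def by (rule infsumI)
qed

text \<open>The vector 2 A mu_k, that is, the linear coefficients obtained by completing the square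
  at mu_k.\<close>

definition hecke_v :: "nat \<Rightarrow> nat \<Rightarrow> real \<times> real" where
  "hecke_v k p = [(2 * real p + 1, 5), (1, 1), (2 * real p + 3, 3), (2 * real p + 1, 1), (1, 3)] ! (k - 1)"

context
  fixes \<tau> q :: complex and p :: nat
  assumes \<tau>: "Im \<tau> > 0" and p: "p \<ge> 1"
  defines "q \<equiv> qpow \<tau> 1"
begin

lemma habiro_hecke_aux:
  assumes a: "a \<le> 1" and D: "\<And>N. norm (D N) \<le> K * norm q ^ N"
    and slice: "\<And>r. ((\<lambda>n. hecke_term \<tau> p v1 v2 (int r) (int n) - (if a = 0 \<and> r = 0 then 0
        else hecke_term \<tau> p v1 v2 (- int r - int a) (- 1 - int n)))
      has_sum qpoch_inf q * (q ^ (p * (r * (r + a))) * bailey_inner q a D r)) UNIV"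
  shows "qpoch_inf q * (\<Sum>\<^sub>\<infinity>s\<in>chains p. D (s p) *
      (\<Prod>i\<in>{1..<p}. q ^ (s i * (s i + a)) * qbinom q (s (i + 1)) (s i)))
    = (\<Sum>\<^sub>\<infinity>(m, n)\<in>{0..} \<times> {0..}. hecke_term \<tau> p v1 v2 m n)
      - (\<Sum>\<^sub>\<infinity>(m, n)\<in>{..<0} \<times> {..<0}. hecke_term \<tau> p v1 v2 m n)"
proof -
  have q: "norm q < 1" unfolding q_def by (rule norm_qpow_1_less[OF \<tau>])
  have "qpoch_inf q * (\<Sum>\<^sub>\<infinity>s\<in>chains p. D (s p) *
      (\<Prod>i\<in>{1..<p}. q ^ (s i * (s i + a)) * qbinom q (s (i + 1)) (s i)))
    = (\<Sum>\<^sub>\<infinity>r. qpoch_inf q * (q ^ (p * (r * (r + a))) * bailey_inner q a D r))"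
    unfolding infsum_chains_bailey[OF q p a D] bailey_inner_def
    by (rule infsum_cmult_right'[symmetric])
  then show ?thesis
    using infsum_hecke_slices[OF hecke_term_summable[OF \<tau> p] a slice] by simp
qed

lemma habiro_hecke:
  assumes k: "k \<in> {1, 2, 3, 4, 5}" and v: "hecke_v k p = (v1, v2)"
  shows "qpoch_inf q * habiro k p q
    = (\<Sum>\<^sub>\<infinity>(m, n)\<in>{0..} \<times> {0..}. hecke_term \<tau> p v1 v2 m n)
      - (\<Sum>\<^sub>\<infinity>(m, n)\<in>{..<0} \<times> {..<0}. hecke_term \<tau> p v1 v2 m n)"
proof -
  have q: "norm q < 1" unfolding q_def by (rule norm_qpow_1_less[OF \<tau>])
  let ?K = "exp (1 / (1 - norm q))"
  have D: "norm (q ^ (c * N) * qpoch q (q ^ n) m) \<le> ?K * norm q ^ N" if "c \<ge> 1" for c N n m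
  proof -
    have "norm (q ^ (c * N)) \<le> norm q ^ N"
      unfolding norm_power using q that by (intro power_decreasing) auto
    then show ?thesis unfolding norm_mult mult.commute[of "norm (q ^ _)"]
      by (intro mult_mono norm_qpoch_le[OF q norm_power_q_le[OF q]]) auto
  qed
  note D1 = D[of 1, simplified] and D2 = D[of 2, simplified]
  consider "k = 1" | "k = 2" | "k = 3" | "k = 4" | "k = 5" using k by auto
  then show ?thesis
  proof cases
    case 1
    have "qpoch_inf q * (\<Sum>\<^sub>\<infinity>s\<in>chains p. q ^ s p * qpoch q (q ^ (s p + 1)) (s p + 1) *
      (\<Prod>i\<in>{1..<p}. q ^ (s i * (s i + 1)) * qbinom q (s (i + 1)) (s i)))
      = (\<Sum>\<^sub>\<infinity>(m, n)\<in>{0..} \<times> {0..}. hecke_term \<tau> p (2 * real p + 1) 5 m n)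
      - (\<Sum>\<^sub>\<infinity>(m, n)\<in>{..<0} \<times> {..<0}. hecke_term \<tau> p (2 * real p + 1) 5 m n)"
      by (rule habiro_hecke_aux[OF _ D1]) (use hecke_slice_1[OF \<tau>, folded q_def] in auto)
    then show ?thesis using 1 v by (simp add: habiro_def habiro1_def hecke_v_def)
  next
    case 2
    \<comment> \<open>The weight exponent \<open>(s i)\<^sup>2\<close> is written as
      \<open>s i * (s i + 0)\<close> to fit the common form with a = 0.\<close>
    have "qpoch_inf q * (\<Sum>\<^sub>\<infinity>s\<in>chains p. q ^ s p * qpoch q (q ^ s p) (s p) *
      (\<Prod>i\<in>{1..<p}. q ^ (s i * (s i + 0)) * qbinom q (s (i + 1)) (s i)))
      = (\<Sum>\<^sub>\<infinity>(m, n)\<in>{0..} \<times> {0..}. hecke_term \<tau> p 1 1 m n)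
      - (\<Sum>\<^sub>\<infinity>(m, n)\<in>{..<0} \<times> {..<0}. hecke_term \<tau> p 1 1 m n)"
      by (rule habiro_hecke_aux[OF _ D1]) (use hecke_slice_2[OF \<tau>, folded q_def] in auto)
    then show ?thesis using 2 v by (simp add: habiro_def habiro2_def hecke_v_def power2_eq_square)
  next
    case 3
    have "qpoch_inf q * (\<Sum>\<^sub>\<infinity>s\<in>chains p. q ^ (2 * s p) * qpoch q (q ^ (s p + 1)) (s p) *
      (\<Prod>i\<in>{1..<p}. q ^ (s i * (s i + 1)) * qbinom q (s (i + 1)) (s i)))
      = (\<Sum>\<^sub>\<infinity>(m, n)\<in>{0..} \<times> {0..}. hecke_term \<tau> p (2 * real p + 3) 3 m n)
      - (\<Sum>\<^sub>\<infinity>(m, n)\<in>{..<0} \<times> {..<0}. hecke_term \<tau> p (2 * real p + 3) 3 m n)"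
      by (rule habiro_hecke_aux[OF _ D2]) (use hecke_slice_3[OF \<tau>, folded q_def] in auto)
    then show ?thesis using 3 v by (simp add: habiro_def habiro3_def hecke_v_def)
  next
    case 4
    have "qpoch_inf q * (\<Sum>\<^sub>\<infinity>s\<in>chains p. q ^ s p * qpoch q (q ^ (s p + 1)) (s p) *
      (\<Prod>i\<in>{1..<p}. q ^ (s i * (s i + 1)) * qbinom q (s (i + 1)) (s i)))
      = (\<Sum>\<^sub>\<infinity>(m, n)\<in>{0..} \<times> {0..}. hecke_term \<tau> p (2 * real p + 1) 1 m n)
      - (\<Sum>\<^sub>\<infinity>(m, n)\<in>{..<0} \<times> {..<0}. hecke_term \<tau> p (2 * real p + 1) 1 m n)"
      by (rule habiro_hecke_aux[OF _ D1]) (use hecke_slice_4[OF \<tau>, folded q_def] in auto)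
    then show ?thesis using 4 v by (simp add: habiro_def habiro4_def hecke_v_def)
  next
    case 5
    have "qpoch_inf q * (\<Sum>\<^sub>\<infinity>s\<in>chains p. q ^ s p * qpoch q (q ^ (s p + 1)) (s p) *
      (\<Prod>i\<in>{1..<p}. q ^ (s i * (s i + 0)) * qbinom q (s (i + 1)) (s i)))
      = (\<Sum>\<^sub>\<infinity>(m, n)\<in>{0..} \<times> {0..}. hecke_term \<tau> p 1 3 m n)
      - (\<Sum>\<^sub>\<infinity>(m, n)\<in>{..<0} \<times> {..<0}. hecke_term \<tau> p 1 3 m n)"
      by (rule habiro_hecke_aux[OF _ D1]) (use hecke_slice_5[OF \<tau>, folded q_def] in auto)
    then show ?thesis using 5 v by (simp add: habiro_def habiro5_def hecke_v_def power2_eq_square)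
  qed
qed

end

section \<open>False theta functions as Hecke-type double sums\<close>

lemma matrix_inv_eqI:
  fixes A B :: "real^'n^'n"
  assumes "A ** B = mat 1"
  shows "matrix_inv A = B"
proof -
  have "\<exists>B. A ** B = mat 1 \<and> B ** A = mat 1"
    using assms matrix_left_right_inverse by blast
  then have "matrix_inv A ** A = mat 1"
    unfolding matrix_inv_def by (rule someI2_ex) simp
  then have "matrix_inv A ** A ** B = B" by (simp add: matrix_mul_lid)
  then show ?thesis unfolding matrix_mul_assoc[symmetric] assms by (simp add: matrix_mul_rid)
qed

text \<open>The denominator is det A = 3 (2p+1) - 4.\<close>

lemma Amat_inv:
  assumes "p \<ge> 1"
  shows "matrix_inv (Amat p) =
    (1 / (6 * real p - 1)) *\<^sub>R vector [vector [3, -2], vector [-2, 2 * real p + 1]]"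
proof (rule matrix_inv_eqI)
  define d where "d = 6 * real p - 1"
  have "d \<noteq> 0" using assms unfolding d_def by linarith
  then show "Amat p ** ((1 / (6 * real p - 1)) *\<^sub>R vector [vector [3, -2], vector [-2, 2 * real p + 1]]) = mat 1"
    unfolding d_def[symmetric]
    by (simp add: Amat_def matrix_matrix_mult_def mat_def vec_eq_iff forall_2 sum_2 field_simps)
      (simp add: d_def)
qed

lemma mu_eq:
  assumes "p \<ge> 1" "k \<in> {1, 2, 3, 4, 5}" "hecke_v k p = (v1, v2)"
  shows "mu k p $ 1 = (3 * v1 - 2 * v2) / (2 * (6 * real p - 1))"
    and "mu k p $ 2 = ((2 * real p + 1) * v2 - 2 * v1) / (2 * (6 * real p - 1))"
proof -
  have "[vector [2 * real p + 1, 5], vector [1, 1], vector [2 * real p + 3, 3],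
      vector [2 * real p + 1, 1], vector [1, 3]] ! (k - 1) = (vector [v1, v2] :: real^2)"
    using assms by (auto simp: hecke_v_def)
  then have mu: "mu k p = (1 / 2) *\<^sub>R (matrix_inv (Amat p) *v vector [v1, v2])"
    by (simp add: mu_def)
  define d where "d = 6 * real p - 1"
  have "mu k p $ 1 = (3 * v1 - 2 * v2) / d / 2" "mu k p $ 2 = ((2 * real p + 1) * v2 - 2 * v1) / d / 2"
    unfolding mu Amat_inv[OF assms(1)] d_def[symmetric]
    by (simp_all add: matrix_vector_mult_def sum_2 diff_divide_distrib)
  then show "mu k p $ 1 = (3 * v1 - 2 * v2) / (2 * (6 * real p - 1))"
    and "mu k p $ 2 = ((2 * real p + 1) * v2 - 2 * v1) / (2 * (6 * real p - 1))"
    by (simp_all add: d_def mult.commute)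
qed

text \<open>The vectors (3,-2) and (-2,2p+1) behind c_1 and c_2 are the columns of det(A) A^(-1),
  and the square roots normalise B(c,c) to 1.\<close>

lemma sgn_Bform_c1:
  assumes "p \<ge> 1"
  shows "sgn (Bform p x (c1 p)) = sgn (x $ 1)"
proof -
  have pos: "6 * real p - 1 > 0" using assms by linarith
  define s where "s = sqrt (3 * (6 * real p - 1))"
  have s: "s > 0" using pos by (simp add: s_def)
  have "Bform p x (c1 p) = (6 * real p - 1) / s * x $ 1"
    unfolding Bform_def c1_def s_def[symmetric] using s
    by (simp add: Amat_def inner_vec_def matrix_vector_mult_def sum_2 field_simps)
  then show ?thesis using pos s by (simp add: sgn_mult)
qed

lemma sgn_Bform_c2:
  assumes "p \<ge> 1"
  shows "sgn (Bform p x (c2 p)) = sgn (x $ 2)"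
proof -
  have pos: "6 * real p - 1 > 0" using assms by linarith
  define s where "s = sqrt ((2 * real p + 1) * (6 * real p - 1))"
  have s: "s > 0" using pos by (simp add: s_def)
  have "Bform p x (c2 p) = (6 * real p - 1) / s * x $ 2"
    unfolding Bform_def c2_def s_def[symmetric] using s
    by (simp add: Amat_def inner_vec_def matrix_vector_mult_def sum_2 field_simps)
  then show ?thesis using pos s by (simp add: sgn_mult)
qed

lemma Qform_eq:
  "Qform p x = ((2 * real p + 1) * (x $ 1)\<^sup>2 + 4 * x $ 1 * x $ 2 + 3 * (x $ 2)\<^sup>2) / 2"
  by (simp add: Qform_def Bform_def Amat_def inner_vec_def matrix_vector_mult_def sum_2
      power2_eq_square algebra_simps)

lemma bij_betw_Llat:
  "bij_betw (\<lambda>(m, n). vector [2 * of_int m, 2 * of_int n] + \<mu>) (UNIV :: (int \<times> int) set)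
     ((\<lambda>x. x + \<mu>) ` Llat)"
proof (rule bij_betw_imageI)
  show "inj (\<lambda>(m, n). vector [2 * of_int m, 2 * of_int n] + \<mu>)"
    by (auto simp: inj_on_def vec_eq_iff forall_2)
  show "(\<lambda>(m, n). vector [2 * of_int m, 2 * of_int n] + \<mu>) ` (UNIV :: (int \<times> int) set)
     = (\<lambda>x. x + \<mu>) ` Llat"
  proof (intro equalityI subsetI)
    fix y assume "y \<in> (\<lambda>(m, n). vector [2 * of_int m, 2 * of_int n] + \<mu>) ` (UNIV :: (int \<times> int) set)"
    then obtain m n :: int where y: "y = vector [2 * of_int m, 2 * of_int n] + \<mu>" by auto
    have "vector [2 * of_int m, 2 * of_int n] \<in> Llat"
      unfolding Llat_def mem_Collect_eq forall_2 by auto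
    then show "y \<in> (\<lambda>x. x + \<mu>) ` Llat" unfolding y by (rule imageI)
  next
    fix y assume "y \<in> (\<lambda>x. x + \<mu>) ` Llat"
    then obtain x where x: "x \<in> Llat" "y = x + \<mu>" by auto
    then obtain m n :: int where "x $ 1 = 2 * of_int m" "x $ 2 = 2 * of_int n"
      unfolding Llat_def by blast
    then have "x = vector [2 * of_int m, 2 * of_int n]" by (simp add: vec_eq_iff forall_2)
    then have "y = (\<lambda>(m, n). vector [2 * of_int m, 2 * of_int n] + \<mu>) (m, n)" using x by simp
    then show "y \<in> (\<lambda>(m, n). vector [2 * of_int m, 2 * of_int n] + \<mu>) ` (UNIV :: (int \<times> int) set)"
      by (rule image_eqI) simp
  qed
qed

section \<open>Cosets of the lattice and shifted signs\<close>

lemma infsum_parity_split: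
  fixes f :: "int \<Rightarrow> int \<Rightarrow> complex"
  assumes f: "(\<lambda>(m, n). f m n) summable_on UNIV"
  shows "(\<Sum>(e1, e2)\<in>{0, 1::nat} \<times> {0, 1::nat}. \<Sum>\<^sub>\<infinity>(m, n). f (2 * m + int e1) (2 * n + int e2))
    = (\<Sum>\<^sub>\<infinity>(m, n). f m n)"
proof -
  let ?E = "{0, 1::nat} \<times> {0, 1::nat}"
  let ?h = "\<lambda>((e1, e2), (m, n)). (2 * m + int e1, 2 * n + int e2)"
  have bij: "bij_betw ?h (?E \<times> UNIV) UNIV"
    by (rule bij_betwI[of _ _ _ "\<lambda>(x, y). ((nat (x mod 2), nat (y mod 2)), (x div 2, y div 2))"]) auto
  have *: "(\<lambda>(e, mn). (\<lambda>(m, n). f m n) (?h (e, mn))) summable_on ?E \<times> UNIV"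
    using f summable_on_reindex_bij_betw[OF bij, of "\<lambda>(m, n). f m n"] by (simp add: case_prod_unfold)
  have "(\<Sum>\<^sub>\<infinity>(m, n). f m n) = (\<Sum>\<^sub>\<infinity>(e, mn)\<in>?E \<times> UNIV. (\<lambda>(m, n). f m n) (?h (e, mn)))"
    using infsum_reindex_bij_betw[OF bij, of "\<lambda>(m, n). f m n"] by (simp add: case_prod_unfold)
  also have "\<dots> = (\<Sum>\<^sub>\<infinity>e\<in>?E. \<Sum>\<^sub>\<infinity>mn. (\<lambda>(m, n). f m n) (?h (e, mn)))"
    using infsum_Sigma'_banach[OF *] by simp
  also have "\<dots> = (\<Sum>e\<in>?E. \<Sum>\<^sub>\<infinity>mn. (\<lambda>(m, n). f m n) (?h (e, mn)))"
    by (rule infsum_finite) simp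
  finally show ?thesis by (simp add: case_prod_unfold)
qed

lemma summable_on_sgn_mult:
  fixes f :: "'a \<Rightarrow> complex"
  assumes "f summable_on A"
  shows "(\<lambda>x. of_real (sgn (s x)) * f x) summable_on A"
  using assms[unfolded summable_on_iff_abs_summable_on_complex]
  by (rule complex_summable_on_comparison) (auto simp: norm_mult sgn_real_def)

lemma infsum_antisymmetric:
  fixes f :: "int \<Rightarrow> complex"
  assumes "\<And>n. f (- 1 - n) = - f n"
  shows "infsum f UNIV = 0"
proof -
  have bij: "bij_betw (\<lambda>n::int. - 1 - n) UNIV UNIV"
    by (rule bij_betwI[of _ _ _ "\<lambda>n. - 1 - n"]) auto
  have "infsum f UNIV = - infsum f UNIV"
    using infsum_reindex_bij_betw[OF bij, of f] by (simp add: assms infsum_uminus)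
  then show ?thesis by simp
qed

text \<open>The value of sgn(m + u) for any 0 < u < 1: unlike in \<open>sgn\<close>, 0 counts as
  positive.\<close>

definition int_sgn :: "int \<Rightarrow> complex" where
  "int_sgn m = (if m \<ge> 0 then 1 else -1)"

text \<open>If \<open>-1 < u < 0\<close>, the shifted sign is wrong precisely on the row \<open>m = 0\<close>, which is required to
  contribute nothing.\<close>

lemma infsum_sgn_shift:
  fixes T :: "int \<Rightarrow> int \<Rightarrow> complex"
  assumes T: "(\<lambda>(m, n). T m n) summable_on UNIV"
    and u: "0 < u \<and> u < 1 \<or> -1 < u \<and> u < 0 \<and> infsum (T 0) UNIV = 0"
  shows "(\<Sum>\<^sub>\<infinity>(m, n). of_real (sgn (of_int m + u)) * T m n) = (\<Sum>\<^sub>\<infinity>(m, n). int_sgn m * T m n)"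
  using u
proof
  assume u: "0 < u \<and> u < 1"
  have "complex_of_real (sgn (of_int m + u)) = int_sgn m" for m
  proof (cases "m \<ge> 0")
    case True
    then have "of_int m + u > 0" using u by (simp add: add_nonneg_pos)
    then show ?thesis using True by (simp add: int_sgn_def)
  next
    case False
    then have "real_of_int m \<le> -1" by linarith
    then have "of_int m + u < 0" using u by linarith
    then show ?thesis using False by (simp add: int_sgn_def)
  qed
  then show ?thesis by simp
next
  assume u: "-1 < u \<and> u < 0 \<and> infsum (T 0) UNIV = 0"
  let ?f = "\<lambda>x. case x of (m, n) \<Rightarrow> T m n"
  have sub: "?f summable_on A" for A using summable_on_subset_banach[OF T] by blast
  \<comment> \<open>Only m = 0 differs: the shifted sign is -1 instead of 1, whence the 2.\<close>
  have sg: "complex_of_real (sgn (of_int m + u)) = int_sgn m - (if m = 0 then 2 else 0)" for m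
  proof (cases "m \<ge> 1")
    case True
    then have "real_of_int m \<ge> 1" by linarith
    then have "of_int m + u > 0" using u by linarith
    then show ?thesis using True by (simp add: int_sgn_def)
  next
    case False
    then have "real_of_int m \<le> 0" by linarith
    then have "of_int m + u < 0" using u by linarith
    then show ?thesis using False by (simp add: int_sgn_def)
  qed
  have int_sgn: "(\<lambda>(m, n). int_sgn m * T m n) summable_on UNIV"
    using T[unfolded summable_on_iff_abs_summable_on_complex]
    by (rule complex_summable_on_comparison) (auto simp: int_sgn_def)
  have "(\<Sum>\<^sub>\<infinity>(m, n). (if m = 0 then 2 else 0) * T m n) = (\<Sum>\<^sub>\<infinity>(m, n)\<in>{0} \<times> UNIV. 2 * T m n)"
    by (rule infsum_cong_neutral) (auto split: if_splits)
  also have "\<dots> = 2 * infsum ?f ({0} \<times> UNIV)"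
    by (simp add: case_prod_unfold infsum_cmult_right')
  also have "infsum ?f ({0} \<times> UNIV) = infsum (T 0) UNIV"
    using infsum_Sigma'_banach[of T "{0}" "\<lambda>_. UNIV"] sub by simp
  finally have 0: "(\<Sum>\<^sub>\<infinity>(m, n). (if m = 0 then 2 else 0) * T m n) = 0" using u by simp
  have 1: "(\<lambda>(m, n). (if m = 0 then 2 else 0) * T m n) summable_on UNIV"
    using summable_on_cmult_right[OF sub[of "{0} \<times> UNIV"], of 2]
    by (subst summable_on_cong_neutral[where T = "{0} \<times> UNIV" and g = "\<lambda>x. 2 * ?f x"]) (auto split: if_splits)
  have "(\<Sum>\<^sub>\<infinity>(m, n). of_real (sgn (of_int m + u)) * T m n)
    = (\<Sum>\<^sub>\<infinity>x. (\<lambda>(m, n). int_sgn m * T m n) x + - (\<lambda>(m, n). (if m = 0 then 2 else 0) * T m n) x)"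
    by (intro infsum_cong) (simp add: sg case_prod_unfold left_diff_distrib)
  also have "\<dots> = (\<Sum>\<^sub>\<infinity>(m, n). int_sgn m * T m n) + - (\<Sum>\<^sub>\<infinity>(m, n). (if m = 0 then 2 else 0) * T m n)"
    using 1 by (subst infsum_add[OF int_sgn]) (simp_all only: infsum_uminus summable_on_uminus)
  finally show ?thesis unfolding 0 by simp
qed

text \<open>The two signs add up to 2 on the nonnegative quadrant and to -2 on the negative one, and
  they cancel on the mixed quadrants.\<close>

lemma infsum_int_sgn_sum:
  fixes T :: "int \<Rightarrow> int \<Rightarrow> complex"
  assumes T: "(\<lambda>(m, n). T m n) summable_on UNIV"
  shows "(\<Sum>\<^sub>\<infinity>(m, n). int_sgn m * T m n) + (\<Sum>\<^sub>\<infinity>(m, n). int_sgn n * T m n)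
    = 2 * ((\<Sum>\<^sub>\<infinity>(m, n)\<in>{0..} \<times> {0..}. T m n) - (\<Sum>\<^sub>\<infinity>(m, n)\<in>{..<0} \<times> {..<0}. T m n))"
proof -
  let ?f = "\<lambda>x. case x of (m, n) \<Rightarrow> T m n"
  let ?P = "{0..} \<times> {0..} :: (int \<times> int) set" and ?N = "{..<0} \<times> {..<0} :: (int \<times> int) set"
  have sub: "?f summable_on A" for A using summable_on_subset_banach[OF T] by blast
  have s: "(\<lambda>(m, n). int_sgn m * T m n) summable_on UNIV" "(\<lambda>(m, n). int_sgn n * T m n) summable_on UNIV"
    by (rule complex_summable_on_comparison[OF T[unfolded summable_on_iff_abs_summable_on_complex]];
        auto simp: int_sgn_def)+
  have "(\<Sum>\<^sub>\<infinity>(m, n). int_sgn m * T m n) + (\<Sum>\<^sub>\<infinity>(m, n). int_sgn n * T m n)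
    = (\<Sum>\<^sub>\<infinity>(m, n). (int_sgn m + int_sgn n) * T m n)"
    using infsum_add[OF s] by (simp add: case_prod_unfold distrib_right)
  also have "\<dots> = (\<Sum>\<^sub>\<infinity>(m, n)\<in>?P \<union> ?N. (int_sgn m + int_sgn n) * T m n)"
    by (rule infsum_cong_neutral) (auto simp: int_sgn_def split: if_splits)
  also have "\<dots> = (\<Sum>\<^sub>\<infinity>(m, n)\<in>?P. (int_sgn m + int_sgn n) * T m n) + (\<Sum>\<^sub>\<infinity>(m, n)\<in>?N. (int_sgn m + int_sgn n) * T m n)"
  proof (rule infsum_Un_disjoint)
    have sum: "(\<lambda>(m, n). (int_sgn m + int_sgn n) * T m n) summable_on A" for A
      using summable_on_subset_banach[OF summable_on_add[OF s], of A]
      by (simp add: case_prod_unfold distrib_right)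
    show "(\<lambda>(m, n). (int_sgn m + int_sgn n) * T m n) summable_on ?P"
      and "(\<lambda>(m, n). (int_sgn m + int_sgn n) * T m n) summable_on ?N" by (rule sum)+
  qed auto
  also have "(\<Sum>\<^sub>\<infinity>(m, n)\<in>?P. (int_sgn m + int_sgn n) * T m n) = (\<Sum>\<^sub>\<infinity>x\<in>?P. 2 * ?f x)"
    by (intro infsum_cong) (auto simp: int_sgn_def)
  also have "(\<Sum>\<^sub>\<infinity>(m, n)\<in>?N. (int_sgn m + int_sgn n) * T m n) = (\<Sum>\<^sub>\<infinity>x\<in>?N. - 2 * ?f x)"
    by (intro infsum_cong) (auto simp: int_sgn_def)
  finally show ?thesis unfolding infsum_cmult_right' by simp
qed

text \<open>On the column n = 0 the exponent is (2p+1) m (m+1) / 2, invariant under m -> -1-m, while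
  the parity of m flips.\<close>

lemma hecke_term_antisymmetric_1: "hecke_term \<tau> p (2 * real p + 1) v2 (- 1 - m) 0 = - hecke_term \<tau> p (2 * real p + 1) v2 m 0"
proof -
  have "(2 * real p + 1) * (real_of_int (- 1 - m))\<^sup>2 + (2 * real p + 1) * of_int (- 1 - m)
    = (2 * real p + 1) * (of_int m)\<^sup>2 + (2 * real p + 1) * of_int m"
    by (simp add: power2_eq_square algebra_simps)
  then show ?thesis by (simp add: hecke_term_def)
qed

text \<open>On the row m = 0 the exponent is 3 n (n+1) / 2, with the same reflection.\<close>

lemma hecke_term_antisymmetric_2: "hecke_term \<tau> p v1 3 0 (- 1 - n) = - hecke_term \<tau> p v1 3 0 n"
proof -
  have e: "(2 * real p + 1) * (of_int 0)\<^sup>2 + 4 * of_int 0 * of_int (- 1 - n)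
      + 3 * (of_int (- 1 - n))\<^sup>2 + v1 * of_int 0 + 3 * of_int (- 1 - n)
    = (2 * real p + 1) * (of_int 0)\<^sup>2 + 4 * of_int 0 * of_int n + 3 * (of_int n)\<^sup>2
      + v1 * of_int 0 + 3 * of_int n"
    by (simp add: power2_eq_square algebra_simps)
  show ?thesis unfolding hecke_term_def e by simp
qed

text \<open>The first coordinate of \<open>\<mu>\<^sub>k\<close> is negative only for \<open>k = 5\<close>, the second only for \<open>k = 4\<close>, and then the
  exceptional row or column cancels under \<open>n \<mapsto> -1-n\<close>. For \<open>(1,1)\<close> and \<open>(1,3)\<close> a coordinate is
  negative as well, but there the exceptional sum does not vanish.\<close>

lemma mu_range:
  assumes p: "p \<ge> 1" and k: "k \<in> {1, 2, 3, 4, 5}" and pk: "(p, k) \<notin> {(1, 1), (1, 3)}"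
    and v: "hecke_v k p = (v1, v2)"
  shows "0 < mu k p $ 1 \<and> mu k p $ 1 < 1 \<or>
      -1 < mu k p $ 1 \<and> mu k p $ 1 < 0 \<and> (\<Sum>\<^sub>\<infinity>n. hecke_term \<tau> p v1 v2 0 n) = 0"
    and "0 < mu k p $ 2 \<and> mu k p $ 2 < 1 \<or>
      -1 < mu k p $ 2 \<and> mu k p $ 2 < 0 \<and> (\<Sum>\<^sub>\<infinity>m. hecke_term \<tau> p v1 v2 m 0) = 0"
proof -
  define d where "d = 2 * (6 * real p - 1)"
  have p1: "real p \<ge> 1" using p by simp
  then have d: "d > 0" by (simp add: d_def)
  \<comment> \<open>The first numerator is 6p - 7 for k = 1, the second 2p - 3 for k = 3; both are
    negative only at p = 1, which is excluded.\<close>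
  have p2: "real p \<ge> 2" if "k = 1 \<or> k = 3"
  proof -
    have "p \<ge> 2" using that pk p by (cases "p = 1") auto
    then show ?thesis by simp
  qed
  have m1: "mu k p $ 1 = (3 * v1 - 2 * v2) / d" and m2: "mu k p $ 2 = ((2 * real p + 1) * v2 - 2 * v1) / d"
    using mu_eq[OF p k v] by (simp_all add: d_def)
  have range: "0 < x / d \<longleftrightarrow> 0 < x" "x / d < 1 \<longleftrightarrow> x < d" "-1 < x / d \<longleftrightarrow> - d < x" "x / d < 0 \<longleftrightarrow> x < 0" for x
    using d by (simp_all add: zero_less_divide_iff divide_less_0_iff divide_less_eq less_divide_eq)
  have z1: "(\<Sum>\<^sub>\<infinity>n. hecke_term \<tau> p v1 3 0 n) = 0"
    by (rule infsum_antisymmetric) (rule hecke_term_antisymmetric_2)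
  have z2: "(\<Sum>\<^sub>\<infinity>m. hecke_term \<tau> p (2 * real p + 1) v2 m 0) = 0"
    by (rule infsum_antisymmetric) (rule hecke_term_antisymmetric_1)
  consider "k = 1" | "k = 2" | "k = 3" | "k = 4" | "k = 5" using k by auto
  then have "(0 < mu k p $ 1 \<and> mu k p $ 1 < 1 \<or>
      -1 < mu k p $ 1 \<and> mu k p $ 1 < 0 \<and> (\<Sum>\<^sub>\<infinity>n. hecke_term \<tau> p v1 v2 0 n) = 0) \<and>
    (0 < mu k p $ 2 \<and> mu k p $ 2 < 1 \<or>
      -1 < mu k p $ 2 \<and> mu k p $ 2 < 0 \<and> (\<Sum>\<^sub>\<infinity>m. hecke_term \<tau> p v1 v2 m 0) = 0)" (is ?R)
  proof cases
    case 1
    then have "v1 = 2 * real p + 1" "v2 = 5" using v by (auto simp: hecke_v_def)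
    then show ?R unfolding m1 m2 range using p2 1 by (simp add: d_def)
  next
    case 2
    then have "v1 = 1" "v2 = 1" using v by (auto simp: hecke_v_def)
    then show ?R unfolding m1 m2 range using p1 by (simp add: d_def)
  next
    case 3
    then have "v1 = 2 * real p + 3" "v2 = 3" using v by (auto simp: hecke_v_def)
    then show ?R unfolding m1 m2 range using p2 3 by (simp add: d_def)
  next
    case 4
    then have "v1 = 2 * real p + 1" "v2 = 1" using v by (auto simp: hecke_v_def)
    then show ?R unfolding m1 m2 range using p1 z2 by (simp add: d_def)
  next
    case 5
    then have "v1 = 1" "v2 = 3" using v by (auto simp: hecke_v_def)
    then show ?R unfolding m1 m2 range using p1 z1 by (simp add: d_def)
  qed
  then show "0 < mu k p $ 1 \<and> mu k p $ 1 < 1 \<or>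
      -1 < mu k p $ 1 \<and> mu k p $ 1 < 0 \<and> (\<Sum>\<^sub>\<infinity>n. hecke_term \<tau> p v1 v2 0 n) = 0"
    and "0 < mu k p $ 2 \<and> mu k p $ 2 < 1 \<or>
      -1 < mu k p $ 2 \<and> mu k p $ 2 < 0 \<and> (\<Sum>\<^sub>\<infinity>m. hecke_term \<tau> p v1 v2 m 0) = 0" by blast+
qed

text \<open>Q(x + mu) = Q(x) + B(x,mu) + Q(mu), and A mu = v/2 turns the middle term into the linear
  part of T.\<close>

lemma Qform_shift:
  assumes p: "p \<ge> 1" and k: "k \<in> {1, 2, 3, 4, 5}" and v: "hecke_v k p = (v1, v2)"
  shows "Qform p (vector [x, y] + mu k p)
    = ((2 * real p + 1) * x\<^sup>2 + 4 * x * y + 3 * y\<^sup>2 + v1 * x + v2 * y) / 2 + Qform p (mu k p)"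
proof -
  let ?u1 = "mu k p $ 1" and ?u2 = "mu k p $ 2"
  define d where "d = 6 * real p - 1"
  have d: "d \<noteq> 0" "real p = (d + 1) / 6" using p by (auto simp: d_def)
  have u: "?u1 = (3 * v1 - 2 * v2) / (2 * d)" "?u2 = ((2 * real p + 1) * v2 - 2 * v1) / (2 * d)"
    using mu_eq[OF p k v] by (simp_all add: d_def)
  have v1: "v1 = 2 * ((2 * real p + 1) * ?u1 + 2 * ?u2)" and v2: "v2 = 2 * (2 * ?u1 + 3 * ?u2)"
    unfolding u d(2) using d(1) by (simp_all add: field_simps)
  show ?thesis
    unfolding Qform_eq by (subst v1, subst v2) (simp add: power2_eq_square field_simps)
qed

text \<open>Q(mu) is v^T A^(-1) v / 8. The form of the adjugate of A takes the value (e_k + 6p - 1)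
  / 3 at v; the part 6p - 1 produces the 1/24 of eta.\<close>

lemma Qform_mu:
  assumes p: "p \<ge> 1" and k: "k \<in> {1, 2, 3, 4, 5}"
  shows "Qform p (mu k p) = ecoef k p / (24 * (6 * real p - 1)) + 1 / 24"
proof -
  obtain v1 v2 where v: "hecke_v k p = (v1, v2)" by fastforce
  define d where "d = 6 * real p - 1"
  have d: "d \<noteq> 0" "real p = (d + 1) / 6" using p by (auto simp: d_def)
  have u: "mu k p $ 1 = (3 * v1 - 2 * v2) / (2 * d)" "mu k p $ 2 = ((2 * real p + 1) * v2 - 2 * v1) / (2 * d)"
    using mu_eq[OF p k v] by (simp_all add: d_def)
  have "Qform p (mu k p) = (3 * v1\<^sup>2 - 4 * v1 * v2 + (2 * real p + 1) * v2\<^sup>2) / (8 * d)"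
    unfolding Qform_eq u d(2) using d(1) by (simp add: power2_eq_square field_simps)
  also have "3 * v1\<^sup>2 - 4 * v1 * v2 + (2 * real p + 1) * v2\<^sup>2 = (ecoef k p + d) / 3"
    using k v by (auto simp: hecke_v_def ecoef_def d_def power2_eq_square algebra_simps)
  also have "(ecoef k p + d) / 3 / (8 * d) = ecoef k p / (24 * d) + 1 / 24"
    using d(1) by (simp add: field_simps)
  finally show ?thesis by (simp add: d_def)
qed

lemma false_theta_infsum:
  "false_theta p \<mu> c \<tau> = (\<Sum>\<^sub>\<infinity>(m, n). of_real (sgn (Bform p (vector [2 * of_int m, 2 * of_int n] + \<mu>) c)) *
     qpow \<tau> (Qform p (vector [2 * of_int m, 2 * of_int n] + \<mu>)))"
  unfolding false_theta_def infsum_reindex_bij_betw[OF bij_betw_Llat, symmetric]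
  by (simp add: case_prod_unfold)

text \<open>On the coset of eps the sign (-1)^(eps1 + eps2) is (-1)^(m+n), so the four signed sums
  merge into one over Z^2. The function \<open>s\<close> stands for either shifted coordinate, which
  covers both c_1 and c_2.\<close>

lemma signed_false_theta_sum:
  assumes p: "p \<ge> 1" and k: "k \<in> {1, 2, 3, 4, 5}" and v: "hecke_v k p = (v1, v2)" and \<tau>: "Im \<tau> > 0"
    and S: "\<And>m n. sgn (Bform p (vector [of_int m, of_int n] + mu k p) c) = sgn (s m n)"
  shows "(\<Sum>(\<epsilon>1, \<epsilon>2)\<in>{0, 1::nat} \<times> {0, 1::nat}. (-1) ^ (\<epsilon>1 + \<epsilon>2) *
      false_theta p (mu k p + vector [real \<epsilon>1, real \<epsilon>2]) c \<tau>)
    = qpow \<tau> (Qform p (mu k p)) * (\<Sum>\<^sub>\<infinity>(m, n). of_real (sgn (s m n)) * hecke_term \<tau> p v1 v2 m n)"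
proof -
  let ?Q = "qpow \<tau> (Qform p (mu k p))"
  define f where "f = (\<lambda>m n. ?Q * (of_real (sgn (s m n)) * hecke_term \<tau> p v1 v2 m n))"
  have "(\<lambda>x. case x of (m, n) \<Rightarrow> hecke_term \<tau> p v1 v2 m n) summable_on UNIV"
    by (rule hecke_term_summable[OF \<tau> p])
  from summable_on_cmult_right[OF summable_on_sgn_mult[OF this, of "\<lambda>x. case x of (m, n) \<Rightarrow> s m n"], of ?Q]
  have f: "(\<lambda>(m, n). f m n) summable_on UNIV"
    by (simp add: f_def case_prod_unfold)
  have "(-1) ^ (e1 + e2) * false_theta p (mu k p + vector [real e1, real e2]) c \<tau>
    = (\<Sum>\<^sub>\<infinity>(m, n). f (2 * m + int e1) (2 * n + int e2))" for e1 e2 :: nat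
    unfolding false_theta_infsum infsum_cmult_right'[symmetric]
  proof (intro infsum_cong, clarify)
    fix m n :: int
    let ?m = "2 * m + int e1" and ?n = "2 * n + int e2"
    have e: "vector [2 * of_int m, 2 * of_int n] + (mu k p + vector [real e1, real e2])
      = vector [of_int ?m, of_int ?n] + mu k p"
      by (simp add: vec_eq_iff forall_2)
    have "even (?m + ?n) \<longleftrightarrow> even (e1 + e2)" by simp
    then show "(-1) ^ (e1 + e2) * (of_real (sgn (Bform p (vector [2 * of_int m, 2 * of_int n] + (mu k p + vector [real e1, real e2])) c)) *
        qpow \<tau> (Qform p (vector [2 * of_int m, 2 * of_int n] + (mu k p + vector [real e1, real e2]))))
      = f ?m ?n"
      unfolding e S Qform_shift[OF p k v] qpow_add f_def hecke_term_def minus_one_power_iff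
      by (simp only: mult_ac)
  qed
  then have "(\<Sum>(\<epsilon>1, \<epsilon>2)\<in>{0, 1::nat} \<times> {0, 1::nat}. (-1) ^ (\<epsilon>1 + \<epsilon>2) *
      false_theta p (mu k p + vector [real \<epsilon>1, real \<epsilon>2]) c \<tau>) = (\<Sum>\<^sub>\<infinity>(m, n). f m n)"
    unfolding infsum_parity_split[OF f, symmetric] by (simp only:)
  then show ?thesis by (simp add: f_def case_prod_unfold infsum_cmult_right')
qed

lemma infsum_swap_pairs: "(\<Sum>\<^sub>\<infinity>(m, n). f m n) = (\<Sum>\<^sub>\<infinity>(n, m). f m n)"
  for f :: "int \<Rightarrow> int \<Rightarrow> complex"
  using infsum_reindex_bij_betw[of prod.swap UNIV UNIV "\<lambda>(n, m). f m n"]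
  by (simp add: case_prod_unfold)

theorem theorem3p15:
  fixes p k :: nat and \<tau> q :: complex
  assumes "p \<ge> 1" and "k \<in> {1, 2, 3, 4, 5}"
    and "(p, k) \<notin> {(1, 1), (1, 3)}"
    and "Im \<tau> > 0"
    and "q = exp (2 * of_real pi * \<i> * \<tau>)"
  shows "habiro k p q =
    qpow \<tau> (- (ecoef k p / (24 * (6 * real p - 1)))) / (2 * dedekind_eta \<tau>) *
    (\<Sum>(\<epsilon>1, \<epsilon>2)\<in>{0, 1::nat} \<times> {0, 1::nat}. (-1) ^ (\<epsilon>1 + \<epsilon>2) *
      (false_theta p (mu k p + vector [real \<epsilon>1, real \<epsilon>2]) (c1 p) \<tau> +
       false_theta p (mu k p + vector [real \<epsilon>1, real \<epsilon>2]) (c2 p) \<tau>))"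
proof -
  note p = assms(1) and k = assms(2) and \<tau> = assms(4)
  obtain v1 v2 where v: "hecke_v k p = (v1, v2)" by fastforce
  have q: "q = qpow \<tau> 1" using assms(5) by (simp add: qpow_def)
  define T where "T = hecke_term \<tau> p v1 v2"
  have T: "(\<lambda>(m, n). T m n) summable_on UNIV"
    unfolding T_def by (rule hecke_term_summable[OF \<tau> p])
  \<comment> \<open>\<open>infsum_sgn_shift\<close> treats the first index, so for c_2 the two
    indices are swapped and swapped back.\<close>
  have T': "(\<lambda>(n, m). T m n) summable_on UNIV"
    using summable_on_reindex_bij_betw[of prod.swap UNIV UNIV "\<lambda>(m, n). T m n"] T
    by (simp add: case_prod_unfold)
  let ?Q = "qpow \<tau> (Qform p (mu k p))"
  have "(\<Sum>(\<epsilon>1, \<epsilon>2)\<in>{0, 1::nat} \<times> {0, 1::nat}. (-1) ^ (\<epsilon>1 + \<epsilon>2) *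
      false_theta p (mu k p + vector [real \<epsilon>1, real \<epsilon>2]) (c1 p) \<tau>)
    = ?Q * (\<Sum>\<^sub>\<infinity>(m, n). of_real (sgn (of_int m + mu k p $ 1)) * T m n)"
    unfolding T_def by (rule signed_false_theta_sum[OF p k v \<tau>]) (simp add: sgn_Bform_c1[OF p])
  also have "(\<Sum>\<^sub>\<infinity>(m, n). of_real (sgn (of_int m + mu k p $ 1)) * T m n) = (\<Sum>\<^sub>\<infinity>(m, n). int_sgn m * T m n)"
    using mu_range(1)[OF p k assms(3) v] by (intro infsum_sgn_shift[OF T]) (simp add: T_def)
  finally have 1: "(\<Sum>(\<epsilon>1, \<epsilon>2)\<in>{0, 1::nat} \<times> {0, 1::nat}. (-1) ^ (\<epsilon>1 + \<epsilon>2) *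
      false_theta p (mu k p + vector [real \<epsilon>1, real \<epsilon>2]) (c1 p) \<tau>) = ?Q * (\<Sum>\<^sub>\<infinity>(m, n). int_sgn m * T m n)" .
  have "(\<Sum>(\<epsilon>1, \<epsilon>2)\<in>{0, 1::nat} \<times> {0, 1::nat}. (-1) ^ (\<epsilon>1 + \<epsilon>2) *
      false_theta p (mu k p + vector [real \<epsilon>1, real \<epsilon>2]) (c2 p) \<tau>)
    = ?Q * (\<Sum>\<^sub>\<infinity>(m, n). of_real (sgn (of_int n + mu k p $ 2)) * T m n)"
    unfolding T_def by (rule signed_false_theta_sum[OF p k v \<tau>]) (simp add: sgn_Bform_c2[OF p])
  also have "(\<Sum>\<^sub>\<infinity>(m, n). of_real (sgn (of_int n + mu k p $ 2)) * T m n)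
      = (\<Sum>\<^sub>\<infinity>(n, m). of_real (sgn (of_int n + mu k p $ 2)) * T m n)"
    by (rule infsum_swap_pairs)
  also have "\<dots> = (\<Sum>\<^sub>\<infinity>(n, m). int_sgn n * T m n)"
    using mu_range(2)[OF p k assms(3) v] by (intro infsum_sgn_shift[OF T']) (simp add: T_def)
  also have "\<dots> = (\<Sum>\<^sub>\<infinity>(m, n). int_sgn n * T m n)"
    by (rule infsum_swap_pairs[symmetric])
  finally have 2: "(\<Sum>(\<epsilon>1, \<epsilon>2)\<in>{0, 1::nat} \<times> {0, 1::nat}. (-1) ^ (\<epsilon>1 + \<epsilon>2) *
      false_theta p (mu k p + vector [real \<epsilon>1, real \<epsilon>2]) (c2 p) \<tau>) = ?Q * (\<Sum>\<^sub>\<infinity>(m, n). int_sgn n * T m n)" .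
  have "(\<Sum>(\<epsilon>1, \<epsilon>2)\<in>{0, 1::nat} \<times> {0, 1::nat}. (-1) ^ (\<epsilon>1 + \<epsilon>2) *
      (false_theta p (mu k p + vector [real \<epsilon>1, real \<epsilon>2]) (c1 p) \<tau> +
       false_theta p (mu k p + vector [real \<epsilon>1, real \<epsilon>2]) (c2 p) \<tau>))
    = ?Q * ((\<Sum>\<^sub>\<infinity>(m, n). int_sgn m * T m n) + (\<Sum>\<^sub>\<infinity>(m, n). int_sgn n * T m n))"
    unfolding distrib_left[of ?Q] 1[symmetric] 2[symmetric]
    by (simp add: case_prod_unfold distrib_left sum.distrib)
  also have "\<dots> = 2 * ?Q * (qpoch_inf q * habiro k p q)"
    unfolding infsum_int_sgn_sum[OF T] unfolding q habiro_hecke[OF \<tau> p k v] T_def by simp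
  finally have sum: "(\<Sum>(\<epsilon>1, \<epsilon>2)\<in>{0, 1::nat} \<times> {0, 1::nat}. (-1) ^ (\<epsilon>1 + \<epsilon>2) *
      (false_theta p (mu k p + vector [real \<epsilon>1, real \<epsilon>2]) (c1 p) \<tau> +
       false_theta p (mu k p + vector [real \<epsilon>1, real \<epsilon>2]) (c2 p) \<tau>))
    = 2 * ?Q * (qpoch_inf q * habiro k p q)" .
  have nz: "qpoch_inf q \<noteq> 0" "qpow \<tau> (1 / 24) \<noteq> 0"
    using qpoch_inf_nonzero[OF norm_qpow_1_less[OF \<tau>]] by (simp_all add: q qpow_def)
  \<comment> \<open>The prefactor cancels all of q^(Q(mu)) except q^(1/24), which eta in the
    denominator removes.\<close>
  have Q: "qpow \<tau> (- (ecoef k p / (24 * (6 * real p - 1)))) * ?Q = qpow \<tau> (1 / 24)"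
    unfolding Qform_mu[OF p k] by (simp flip: qpow_add)
  show ?thesis
    unfolding sum dedekind_eta_def q[symmetric] using nz
    by (simp add: field_simps Q[symmetric])
qed

end
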